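(* Let $F(\cdot;\xi):\mathbb{R}^n\to\mathbb{R}$ be differentiable (possibly nonconvex) for every $\xi\in\Xi$, with $\|\nabla F(x;\xi)-\nabla F(y;\xi)\|\le L\|x-y\|$ for all $x,y\in\mathbb{R}^n$, $\xi\in\Xi$, with $\sup_{x\in\mathbb{R}^n,\xi\in\Xi}\|\nabla F(x;\xi)\|<+\infty$, and with $\mathbb{E}_\xi\nabla F(x;\xi)=\nabla\,\mathbb{E}_\xi F(x;\xi)$ for all $x$. Assume $x\mapsto\mathbb{E}_\xi F(x;\xi)$ attains its minimum over $\mathbb{R}^n$. Let $(\xi^k)_{k\ge0}$ be a time-homogeneous, irreducible, aperiodic, reversible Markov chain on $\Xi$ with stationary distribution $\Pi$ and geometric mixing rate $\lambda\in(0,1)$. Let the positive stepsizes $(\gamma_k)_{k\ge0}$ satisfy $$\sum_k\gamma_k=+\infty,\qquad\sum_{k\ge1}\ln^2k\cdot\gamma_k^2<+\infty,$$ let $(e^k)_{k\ge0}\subset\mathbb{R}^n$ satisfy $\sum_{k=1}^\infty\gamma_k\|e^k\|<+\infty$, and let $(x^k)_{k\ge0}$ be generated from a deterministic $x^0\in\mathbb{R}^n$ by $$x^{k+1}=x^k-\gamma_k\big(\nabla F(x^k;\xi^k)+e^k\big).$$ Then $$\lim_k\mathbb{E}\|\nabla\mathbb{E}_\xi(F(x^k;\xi))\|=0,\qquad \mathbb{E}\Big(\min_{1\le i\le k}\|\nabla\mathbb{E}_\xi(F(x^i;\xi))\|^2\Big)=O\Big(\frac{\max\{1,\frac1{\l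n(1/\lambda)}\}}{\sum_{i=1}^k\gamma_i}\Big).$$
   Context: $\Xi$ is a (possibly continuous) statistical sample space with probability distribution $\Pi$. $\mathbb{E}_\xi$ denotes expectation over $\xi\sim\Pi$ with the first argument of $F$ held fixed, so $\nabla\mathbb{E}_\xi(F(x^k;\xi))$ is the gradient of $x\mapsto\mathbb{E}_\xi F(x;\xi)$ evaluated at the random point $x^k$; the outer $\mathbb{E}$ is over the Markov chain trajectory. $F$ is assumed measurable in $\xi$ (and integrable) so that all expectations make sense. $(e^k)$ is deterministic. Geometric mixing rate $\lambda\in(0,1)$ means: there is a constant $C>0$ such that for every $t\ge0$ and every starting state, the $t$-step transition distribution has density $p_0^t$ and $\Pi$ has density $\pi$ with respect to a reference measure $\mu$ on $\Xi$, and $\int_\Xi|p_0^t(\xi)-\pi(\xi)|\,d\mu(\xi)\le C\lambda^t$ (equivalently, the total variation distance to $\Pi$ decays like $\lambda^t$, uniformly in the starting state). $O(\cdot)$ is as $k\to\infty$, with implied constant not depending on $k$. *)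

theory Defs
  imports "HOL-Probability.Probability" "HOL-Library.Landau_Symbols"
begin

definition grad :: "('a::real_inner \<Rightarrow> real) \<Rightarrow> 'a \<Rightarrow> 'a" where
  "grad f x = (THE D. GDERIV f x :> D)"

lemma grad_eqI:
  assumes "GDERIV f x :> D"
  shows "grad f x = D"
  unfolding grad_def
proof (rule the_equality)
  show "GDERIV f x :> D" by (rule assms)
next
  fix D' assume "GDERIV f x :> D'"
  then have "(\<lambda>h. inner h D') = (\<lambda>h. inner h D)"
    using assms has_derivative_unique unfolding gderiv_def by blast
  then have "inner h D' = inner h D" for h by metis
  then show "D' = D" by (metis inner_commute vector_eq_ldot)
qed

text \<open>
  In the following, a state space is given by the measurable space underlying a measure
  \<open>S\<close>, and a Markov kernel on it is a measurable map \<open>K \<in> S \<rightarrow>\<^sub>M prob_algebra S\<close>.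
\<close>

primrec kernel_power :: "'s measure \<Rightarrow> ('s \<Rightarrow> 's measure) \<Rightarrow> nat \<Rightarrow> 's \<Rightarrow> 's measure" where
  "kernel_power S K 0 x = return S x"
| "kernel_power S K (Suc t) x = kernel_power S K t x \<bind> K"

definition past :: "'w measure \<Rightarrow> 's measure \<Rightarrow> (nat \<Rightarrow> 'w \<Rightarrow> 's) \<Rightarrow> nat \<Rightarrow> 'w measure" where
  "past M S X k = sigma (space M) {X i -` A \<inter> space M | i A. i \<le> k \<and> A \<in> sets S}"

text \<open>
  The kernel does not depend on the time index (time-homogeneity); the law of \<open>X 0\<close> is
  arbitrary.
\<close>

definition markov_chain ::
    "'w measure \<Rightarrow> 's measure \<Rightarrow> ('s \<Rightarrow> 's measure) \<Rightarrow> (nat \<Rightarrow> 'w \<Rightarrow> 's) \<Rightarrow> bool" where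
  "markov_chain M S K X \<longleftrightarrow>
     prob_space M \<and> K \<in> S \<rightarrow>\<^sub>M prob_algebra S \<and> (\<forall>k. X k \<in> M \<rightarrow>\<^sub>M S) \<and>
     (\<forall>k. \<forall>A\<in>sets S. AE \<omega> in M.
        real_cond_exp M (past M S X k) (indicator (X (Suc k) -` A \<inter> space M)) \<omega>
          = measure (K (X k \<omega>)) A)"

definition stationary :: "('s \<Rightarrow> 's measure) \<Rightarrow> 's measure \<Rightarrow> bool" where
  "stationary K \<pi> \<longleftrightarrow> \<pi> \<bind> K = \<pi>"

definition reversible :: "('s \<Rightarrow> 's measure) \<Rightarrow> 's measure \<Rightarrow> bool" where
  "reversible K \<pi> \<longleftrightarrow> (\<forall>A\<in>sets \<pi>. \<forall>B\<in>sets \<pi>.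
     (\<integral>\<^sup>+x\<in>A. emeasure (K x) B \<partial>\<pi>) = (\<integral>\<^sup>+x\<in>B. emeasure (K x) A \<partial>\<pi>))"

text \<open>
  Irreducibility and aperiodicity on general state spaces, as in Meyn--Tweedie and
  Roberts--Rosenthal. An irreducible chain on a countable space, in the elementary sense, is
  irreducible in this sense (take \<open>\<phi>\<close> to be counting measure).
\<close>

definition irreducible_kernel :: "'s measure \<Rightarrow> ('s \<Rightarrow> 's measure) \<Rightarrow> bool" where
  "irreducible_kernel S K \<longleftrightarrow>
     (\<exists>\<phi>. sets \<phi> = sets S \<and> sigma_finite_measure \<phi> \<and> emeasure \<phi> (space \<phi>) \<noteq> 0 \<and>
        (\<forall>A\<in>sets S. emeasure \<phi> A > 0 \<longrightarrow>
           (\<forall>x\<in>space S. \<exists>t>0. measure (kernel_power S K t x) A > 0)))"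

definition aperiodic_kernel :: "('s \<Rightarrow> 's measure) \<Rightarrow> 's measure \<Rightarrow> bool" where
  "aperiodic_kernel K \<pi> \<longleftrightarrow>
     \<not> (\<exists>d\<ge>2. \<exists>D :: nat \<Rightarrow> 's set.
          (\<forall>i<d. D i \<in> sets \<pi>) \<and> disjoint_family_on D {..<d} \<and> measure \<pi> (D 0) > 0 \<and>
          (\<forall>i<d. \<forall>x\<in>D i. measure (K x) (D (Suc i mod d)) = 1))"

text \<open>
  The \<open>L\<^sup>1\<close> distance of the densities does not depend on the reference measure \<open>\<mu>\<close>, which
  may therefore vary with \<open>t\<close> and \<open>x\<close>. A single \<open>\<sigma>\<close>-finite \<open>\<mu>\<close> dominating all the \<open>kernel_power \<pi> K t x\<close>
  would rule out continuous state spaces: for \<open>t = 0\<close> these are the point masses, and kernels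
  such as Metropolis--Hastings keep an atom at \<open>x\<close> for all \<open>t\<close>.
\<close>

definition geometric_mixing :: "('s \<Rightarrow> 's measure) \<Rightarrow> 's measure \<Rightarrow> real \<Rightarrow> bool" where
  "geometric_mixing K \<pi> r \<longleftrightarrow>
     (\<exists>C>0. \<forall>t. \<forall>x\<in>space \<pi>. \<exists>\<mu> p q.
        sets \<mu> = sets \<pi> \<and>
        p \<in> borel_measurable \<mu> \<and> (\<forall>s. 0 \<le> p s) \<and>
        q \<in> borel_measurable \<mu> \<and> (\<forall>s. 0 \<le> q s) \<and>
        kernel_power \<pi> K t x = density \<mu> (\<lambda>s. ennreal (p s)) \<and>
        \<pi> = density \<mu> (\<lambda>s. ennreal (q s)) \<and>
        (\<integral>s. \<bar>p s - q s\<bar> \<partial>\<mu>) \<le> C * r ^ t)"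

end

theory Submission
  imports Defs
begin

text \<open>
  Write \<open>G = \<nabla>\<^bold>E\<^sub>\<xi> F\<close> and \<open>\<phi>(y, s) = \<langle>G y, G y - \<nabla>F(y; s)\<rangle>\<close>. The descent inequality bounds
  \<open>\<Sum> \<gamma>\<^sub>k |G x\<^sub>k|\<^sup>2\<close> by a constant, summable terms and \<open>\<Sum> \<gamma>\<^sub>k \<phi>(x\<^sub>k, \<xi>\<^sub>k)\<close>. Since \<open>\<phi>(y, \<cdot>)\<close> has
  \<open>\<Pi>\<close>-mean zero and \<open>\<phi>(\<cdot>, s)\<close> is Lipschitz, telescoping \<open>\<phi>(x\<^sub>k, \<xi>\<^sub>k)\<close> over the iterates \<open>x\<^sub>j\<close>, \<open>j \<le> k\<close>,
  with \<open>\<xi>\<^sub>k\<close> kept fixed bounds its expectation by a multiple of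
  \<open>\<lambda>\<^sup>k + \<Sum>\<^sub>j \<lambda>\<^bsup>k - j\<^esup> |x\<^sub>j\<^sub>+\<^sub>1 - x\<^sub>j|\<close>, and the sum of these bounds against \<open>\<gamma>\<^sub>k\<close> converges as soon as
  \<open>\<Sum> \<gamma>\<^sub>k\<^sup>2\<close> does. Hence \<open>\<Sum> \<gamma>\<^sub>k \<^bold>E|G x\<^sub>k|\<^sup>2 < \<infinity>\<close>, from which both claims follow.
\<close>

section \<open>Joint measurability, gradients and the descent inequality\<close>

text \<open>Replacing the first argument by a simple approximation \<open>q i\<close> leaves
  finitely many measurable sections to glue, and continuity in the first argument recovers
  \<open>g\<close> as their pointwise limit. This makes the sampled gradient at a random iterate
  measurable.\<close>

lemma borel_measurable_caratheodory:
  fixes g :: "'a::{metric_space, second_countable_topology} \<Rightarrow> 's \<Rightarrow> 'b::metric_space"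
  assumes meas: "\<And>x. g x \<in> borel_measurable M"
    and cont: "\<And>s. s \<in> space M \<Longrightarrow> continuous_on UNIV (\<lambda>x. g x s)"
  shows "(\<lambda>(x, s). g x s) \<in> borel_measurable (borel \<Otimes>\<^sub>M M)"
proof -
  \<comment> \<open>Simple functions converging to the identity. \<open>undefined\<close> is the
    base point of an accompanying distance bound that is discarded here, so any point
    serves.\<close>
  obtain q :: "nat \<Rightarrow> 'a \<Rightarrow> 'a" where q: "\<And>i. simple_function borel (q i)"
      "\<And>x. (\<lambda>i. q i x) \<longlonglongrightarrow> x"
    using borel_measurable_implies_sequence_metric[of "\<lambda>x::'a. x" borel undefined] by auto
  show ?thesis
  proof (rule borel_measurable_LIMSEQ_metric)
    fix i
    show "(\<lambda>(x, s). g (q i x) s) \<in> borel_measurable (borel \<Otimes>\<^sub>M M)"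
      unfolding split_beta'
    proof (rule measurable_compose_countable'[where I = "range (q i)" and f = "\<lambda>y p. g y (snd p)"])
      show "(\<lambda>p. q i (fst p)) \<in> borel \<Otimes>\<^sub>M M \<rightarrow>\<^sub>M count_space (range (q i))"
        using simple_functionD[OF q(1)[of i]] measurable_simple_function[OF q(1)[of i]]
        by (intro measurable_compose[OF measurable_fst] measurable_count_space_eq2[THEN iffD2])
          (auto simp: space_borel)
      show "countable (range (q i))"
        using simple_functionD(1)[OF q(1)[of i]] by (simp add: countable_finite)
    qed (use meas in measurable)
  next
    fix p :: "'a \<times> 's" assume "p \<in> space (borel \<Otimes>\<^sub>M M)"
    then have "isCont (\<lambda>x. g x (snd p)) (fst p)"
      using cont[of "snd p"] by (auto simp: space_pair_measure continuous_on_eq_continuous_at)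
    from isCont_tendsto_compose[OF this q(2)]
    show "(\<lambda>i. (\<lambda>(x, s). g (q i x) s) p) \<longlonglongrightarrow> (\<lambda>(x, s). g x s) p"
      by (simp add: split_beta')
  qed
qed

text \<open>Finite-dimensional Riesz representation: the adjoint of the derivative, applied to
  \<open>1\<close>, is the gradient vector. Hence the definite description in \<open>grad\<close>
  denotes a gradient wherever the function is differentiable.\<close>

lemma differentiable_imp_GDERIV:
  fixes f :: "'a::euclidean_space \<Rightarrow> real"
  assumes "f differentiable (at x)"
  shows "GDERIV f x :> grad f x"
proof -
  obtain f' where f': "(f has_derivative f') (at x)"
    using assms by (auto simp: differentiable_def)
  have "f' = (\<lambda>h. inner h (adjoint f' 1))"
    using adjoint_works[OF has_derivative_linear[OF f'], of _ 1] by auto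
  then have "GDERIV f x :> adjoint f' 1"
    using f' unfolding gderiv_def by metis
  then show ?thesis by (simp add: grad_eqI)
qed

lemma GDERIV_has_real_derivative_line:
  assumes "GDERIV f (x + t *\<^sub>R h) :> D"
  shows "((\<lambda>t. f (x + t *\<^sub>R h)) has_real_derivative inner h D) (at t)"
proof -
  have "((\<lambda>t. x + t *\<^sub>R h) has_derivative (\<lambda>t. t *\<^sub>R h)) (at t)"
    by (auto intro!: derivative_eq_intros)
  from diff_chain_at[OF this assms[unfolded gderiv_def]] show ?thesis
    by (simp add: has_field_derivative_def o_def mult.commute[of _ "inner h D"])
qed

text \<open>Each coordinate of the gradient is the pointwise limit of difference quotients with
  increments \<open>inverse (Suc n)\<close>, and each quotient is measurable in
  \<open>s\<close>.\<close>

lemma borel_measurable_grad: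
  fixes F :: "'a::euclidean_space \<Rightarrow> 's \<Rightarrow> real"
  assumes meas[measurable]: "\<And>y. F y \<in> borel_measurable M"
    and diff: "\<And>s. s \<in> space M \<Longrightarrow> (\<lambda>z. F z s) differentiable (at y)"
  shows "(\<lambda>s. grad (\<lambda>u. F u s) y) \<in> borel_measurable M"
proof (subst borel_measurable_euclidean_space, intro ballI)
  fix b :: 'a
  show "(\<lambda>s. inner (grad (\<lambda>u. F u s) y) b) \<in> borel_measurable M"
  proof (rule borel_measurable_LIMSEQ_real)
    fix s assume s: "s \<in> space M"
    have "((\<lambda>t. F (y + t *\<^sub>R b) s) has_real_derivative inner b (grad (\<lambda>u. F u s) y)) (at 0)"
      using differentiable_imp_GDERIV[OF diff[OF s]]
      by (intro GDERIV_has_real_derivative_line) simp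
    then have "((\<lambda>h. (F (y + h *\<^sub>R b) s - F y s) / h) \<longlongrightarrow> inner b (grad (\<lambda>u. F u s) y)) (at 0)"
      by (simp add: DERIV_def)
    then have "filterlim (\<lambda>n. (F (y + inverse (real (Suc n)) *\<^sub>R b) s - F y s) / inverse (real (Suc n)))
        (nhds (inner b (grad (\<lambda>u. F u s) y))) sequentially"
      by (rule filterlim_compose)
        (use LIMSEQ_inverse_real_of_nat in \<open>auto simp: filterlim_at simp del: of_nat_Suc\<close>)
    then show "(\<lambda>n. (F (y + inverse (real (Suc n)) *\<^sub>R b) s - F y s) / inverse (real (Suc n)))
        \<longlonglongrightarrow> inner (grad (\<lambda>u. F u s) y) b"
      by (simp add: inner_commute)
  qed measurable
qed

text \<open>Mean value theorem on the segment from \<open>x\<close> to \<open>y\<close>, then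
  Cauchy-Schwarz and the Lipschitz bound. The constant is \<open>L\<close> instead of the sharp
  \<open>L / 2\<close> from integrating along the segment; the factor does not affect
  summability.\<close>

lemma lipschitz_gradient_descent:
  assumes G: "\<And>y. GDERIV f y :> G y"
    and lip: "\<And>y z. norm (G y - G z) \<le> L * norm (y - z)" and "L \<ge> 0"
  shows "f y \<le> f x + inner (y - x) (G x) + L * (norm (y - x))\<^sup>2"
proof -
  have "\<And>t. ((\<lambda>t. f (x + t *\<^sub>R (y - x))) has_real_derivative
      inner (y - x) (G (x + t *\<^sub>R (y - x)))) (at t)"
    by (rule GDERIV_has_real_derivative_line[OF G])
  from MVT2[of 0 1, OF _ this] obtain t where t: "0 < t" "t < 1"
      "f y - f x = inner (y - x) (G (x + t *\<^sub>R (y - x)))" by auto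
  have "inner (y - x) (G (x + t *\<^sub>R (y - x)) - G x)
      \<le> norm (y - x) * norm (G (x + t *\<^sub>R (y - x)) - G x)"
    by (rule norm_cauchy_schwarz)
  also have "\<dots> \<le> norm (y - x) * (L * norm (y - x))"
  proof (rule mult_left_mono)
    have "norm (G (x + t *\<^sub>R (y - x)) - G x) \<le> L * (t * norm (y - x))"
      using lip[of "x + t *\<^sub>R (y - x)" x] t by simp
    also have "\<dots> \<le> L * (1 * norm (y - x))"
      using t \<open>L \<ge> 0\<close> by (intro mult_left_mono mult_right_mono) auto
    finally show "norm (G (x + t *\<^sub>R (y - x)) - G x) \<le> L * norm (y - x)" by simp
  qed simp
  finally show ?thesis using t(3) by (simp add: inner_diff_right power2_eq_square algebra_simps)
qed

section \<open>The filtration of the chain and the Markov property\<close>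

lemma space_past [simp]: "space (past M S X k) = space M"
  by (auto simp: past_def space_measure_of_conv)

lemma sets_past:
  "sets (past M S X k) = sigma_sets (space M) {X i -` A \<inter> space M | i A. i \<le> k \<and> A \<in> sets S}"
  unfolding past_def by (rule sets_measure_of) auto

lemma sets_past_mono: "j \<le> k \<Longrightarrow> sets (past M S X j) \<subseteq> sets (past M S X k)"
  unfolding sets_past by (rule sigma_sets_mono') force

lemma measurable_past_mono:
  "j \<le> k \<Longrightarrow> Y \<in> past M S X j \<rightarrow>\<^sub>M N \<Longrightarrow> Y \<in> past M S X k \<rightarrow>\<^sub>M N"
  using sets_past_mono[of j k M S X] by (auto simp: measurable_def)

lemma subalgebra_past:
  assumes "\<And>k. X k \<in> M \<rightarrow>\<^sub>M S"
  shows "subalgebra M (past M S X k)"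
  unfolding subalgebra_def sets_past
  using assms by (auto intro!: sets.sigma_sets_subset)

lemma measurable_past_process:
  assumes "\<And>k. X k \<in> M \<rightarrow>\<^sub>M S" "i \<le> k"
  shows "X i \<in> past M S X k \<rightarrow>\<^sub>M S"
proof (rule measurableI)
  fix A assume "A \<in> sets S"
  then show "X i -` A \<inter> space (past M S X k) \<in> sets (past M S X k)"
    using assms(2) by (simp add: sets_past) (rule sigma_sets.Basic, blast)
qed (use assms(1)[THEN measurable_space] in auto)

lemma measurable_kernel_power:
  assumes "K \<in> S \<rightarrow>\<^sub>M prob_algebra S"
  shows "kernel_power S K t \<in> S \<rightarrow>\<^sub>M prob_algebra S"
proof (induction t)
  case 0
  have "kernel_power S K 0 = return S" by auto
  then show ?case by simp
next
  case (Suc t)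
  have "kernel_power S K (Suc t) = (\<lambda>x. kernel_power S K t x \<bind> K)" by auto
  then show ?case using measurable_bind_prob_space[OF Suc assms] by simp
qed

text \<open>Integrates the conditional probability in \<open>markov_chain\<close> over the past
  event \<open>A\<close>. The identity is real-valued; the conversion to \<open>emeasure\<close>
  prepares the uniqueness argument for measures that follows.\<close>

lemma markov_chain_step_rectangle:
  assumes mc: "markov_chain M S K X" and A: "A \<in> sets (past M S X k)" and B: "B \<in> sets S"
  shows "emeasure M (A \<inter> X (Suc k) -` B \<inter> space M)
    = (\<integral>\<^sup>+\<omega>. indicator A \<omega> * emeasure (K (X k \<omega>)) B \<partial>M)"
proof -
  interpret prob_space M using mc by (simp add: markov_chain_def)
  have K: "K \<in> S \<rightarrow>\<^sub>M prob_algebra S" and X: "\<And>k. X k \<in> M \<rightarrow>\<^sub>M S"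
    using mc by (auto simp: markov_chain_def)
  note X[measurable] B[measurable]
  interpret finite_measure_subalgebra M "past M S X k"
    by unfold_locales (rule subalgebra_past[OF X])
  have A'[measurable]: "A \<in> sets M" using A subalg by (auto simp: subalgebra_def)
  let ?E = "X (Suc k) -` B \<inter> space M"
  have [measurable]: "(\<lambda>\<omega>. measure (K (X k \<omega>)) B) \<in> borel_measurable M"
    using K by measurable
  have Kp: "prob_space (K (X k \<omega>))" if "\<omega> \<in> space M" for \<omega>
    using measurable_space[OF K] measurable_space[OF X that] by (auto simp: space_prob_algebra)
  have int: "integrable M (\<lambda>\<omega>. indicator A \<omega> * measure (K (X k \<omega>)) B)"
  proof (rule integrable_const_bound[where B = 1])
    show "AE \<omega> in M. norm (indicator A \<omega> * measure (K (X k \<omega>)) B) \<le> (1::real)"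
      using Kp by (auto simp: indicator_def prob_space.prob_le_1)
  qed measurable
  have "measure M (A \<inter> ?E) = (\<integral>\<omega>\<in>A. indicator ?E \<omega> \<partial>M)"
    by (simp add: set_lebesgue_integral_def indicator_inter_arith[symmetric] Int_absorb2 sets.sets_into_space)
  also have "\<dots> = (\<integral>\<omega>\<in>A. real_cond_exp M (past M S X k) (indicator ?E) \<omega> \<partial>M)"
    by (rule real_cond_exp_intA) (use A in \<open>auto simp: integrable_indicator_iff emeasure_eq_measure\<close>)
  also have "\<dots> = (\<integral>\<omega>. indicator A \<omega> * measure (K (X k \<omega>)) B \<partial>M)"
    unfolding set_lebesgue_integral_def
  proof (rule integral_cong_AE)
    have "AE \<omega> in M. real_cond_exp M (past M S X k) (indicator ?E) \<omega> = measure (K (X k \<omega>)) B"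
      using mc B unfolding markov_chain_def by blast
    then show "AE \<omega> in M. indicator A \<omega> *\<^sub>R real_cond_exp M (past M S X k) (indicator ?E) \<omega>
      = indicator A \<omega> * measure (K (X k \<omega>)) B"
      by eventually_elim simp
  qed measurable
  finally have "emeasure M (A \<inter> ?E) = ennreal (\<integral>\<omega>. indicator A \<omega> * measure (K (X k \<omega>)) B \<partial>M)"
    by (simp add: emeasure_eq_measure)
  also have "\<dots> = (\<integral>\<^sup>+\<omega>. ennreal (indicator A \<omega> * measure (K (X k \<omega>)) B) \<partial>M)"
    using int by (rule nn_integral_eq_integral[symmetric]) auto
  also have "\<dots> = (\<integral>\<^sup>+\<omega>. indicator A \<omega> * emeasure (K (X k \<omega>)) B \<partial>M)"
  proof (rule nn_integral_cong)
    fix \<omega> assume "\<omega> \<in> space M"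
    then interpret k: prob_space "K (X k \<omega>)" by (rule Kp)
    show "ennreal (indicator A \<omega> * measure (K (X k \<omega>)) B) = indicator A \<omega> * emeasure (K (X k \<omega>)) B"
      by (auto simp: indicator_def k.emeasure_eq_measure)
  qed
  finally show ?thesis by (simp add: Int_assoc)
qed

text \<open>The joint law of \<open>Y\<close> and \<open>X (Suc k)\<close> and the mixture of the
  laws \<open>?Q\<close> agree on rectangles, an intersection-stable generator of the product
  sigma-algebra, so they are equal and integrate every \<open>f\<close> alike.\<close>

lemma markov_chain_step:
  assumes mc: "markov_chain M S K X" and Y: "Y \<in> past M S X k \<rightarrow>\<^sub>M N"
    and f[measurable]: "f \<in> borel_measurable (N \<Otimes>\<^sub>M S)"
  shows "(\<integral>\<^sup>+\<omega>. f (Y \<omega>, X (Suc k) \<omega>) \<partial>M) = (\<integral>\<^sup>+\<omega>. \<integral>\<^sup>+s. f (Y \<omega>, s) \<partial>K (X k \<omega>) \<partial>M)"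
proof -
  interpret prob_space M using mc by (simp add: markov_chain_def)
  have K[measurable]: "K \<in> S \<rightarrow>\<^sub>M prob_algebra S" and X[measurable]: "\<And>k. X k \<in> M \<rightarrow>\<^sub>M S"
    using mc by (auto simp: markov_chain_def)
  have Y'[measurable]: "Y \<in> M \<rightarrow>\<^sub>M N"
    using measurable_from_subalg[OF subalgebra_past[OF X] Y] .
  let ?Q = "\<lambda>\<omega>. distr (K (X k \<omega>)) (N \<Otimes>\<^sub>M S) (Pair (Y \<omega>))"
  let ?D = "distr M (N \<Otimes>\<^sub>M S) (\<lambda>\<omega>. (Y \<omega>, X (Suc k) \<omega>))"
  have Q: "?Q \<in> M \<rightarrow>\<^sub>M prob_algebra (N \<Otimes>\<^sub>M S)"
    by (rule measurable_distr_prob_space2[where M = S]) measurable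
  have sK: "sets (K (X k \<omega>)) = sets S" if "\<omega> \<in> space M" for \<omega>
    using measurable_space[OF K] measurable_space[OF X that] by (auto simp: space_prob_algebra)
  have PY: "Pair (Y \<omega>) \<in> K (X k \<omega>) \<rightarrow>\<^sub>M N \<Otimes>\<^sub>M S" if "\<omega> \<in> space M" for \<omega>
    using measurable_space[OF Y' that] sK[OF that] by (simp cong: measurable_cong_sets)
  \<comment> \<open>Since \<open>?D\<close> is finite, the exhausting sequence in the uniqueness
    theorem can be constantly the whole space.\<close>
  have "?D = M \<bind> ?Q"
  proof (rule measure_eqI_generator_eq[OF Int_stable_pair_measure_generator[of N S],
        where \<Omega> = "space N \<times> space S" and A = "\<lambda>_. space N \<times> space S"])
    show "sets (M \<bind> ?Q) = sigma_sets (space N \<times> space S) {a \<times> b |a b. a \<in> sets N \<and> b \<in> sets S}"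
      using sets_bind[OF _ not_empty, of ?Q "N \<Otimes>\<^sub>M S"] by (simp add: sets_pair_measure)
    fix Z assume "Z \<in> {a \<times> b |a b. a \<in> sets N \<and> b \<in> sets S}"
    then obtain A B where Z: "Z = A \<times> B" and [measurable]: "A \<in> sets N" "B \<in> sets S" by auto
    have "emeasure ?D Z = emeasure M ((Y -` A \<inter> space M) \<inter> X (Suc k) -` B \<inter> space M)"
      by (simp add: Z emeasure_distr) (rule arg_cong[where f = "emeasure M"], auto)
    also have "\<dots> = (\<integral>\<^sup>+\<omega>. indicator (Y -` A \<inter> space M) \<omega> * emeasure (K (X k \<omega>)) B \<partial>M)"
      using measurable_sets[OF Y, of A] by (intro markov_chain_step_rectangle[OF mc]) auto
    also have "\<dots> = (\<integral>\<^sup>+\<omega>. emeasure (?Q \<omega>) Z \<partial>M)"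
    proof (rule nn_integral_cong)
      fix \<omega> assume \<omega>: "\<omega> \<in> space M"
      have "Pair (Y \<omega>) -` (A \<times> B) \<inter> space (K (X k \<omega>)) = (if Y \<omega> \<in> A then B else {})"
        using sets.sets_into_space[of B S] sets_eq_imp_space_eq[OF sK[OF \<omega>]] by auto
      then show "indicator (Y -` A \<inter> space M) \<omega> * emeasure (K (X k \<omega>)) B = emeasure (?Q \<omega>) Z"
        using \<omega> PY[OF \<omega>] by (auto simp: Z emeasure_distr indicator_def)
    qed
    also have "\<dots> = emeasure (M \<bind> ?Q) Z"
      by (rule emeasure_bind[symmetric, OF not_empty measurable_prob_algebraD[OF Q]]) (auto simp: Z)
    finally show "emeasure ?D Z = emeasure (M \<bind> ?Q) Z" .
  next
    show "emeasure ?D (space N \<times> space S) \<noteq> \<infinity>"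
      by (simp add: emeasure_distr)
  qed (auto simp: sets_pair_measure dest: sets.sets_into_space)
  then have "(\<integral>\<^sup>+p. f p \<partial>?D) = (\<integral>\<^sup>+p. f p \<partial>(M \<bind> ?Q))" by simp
  also have "\<dots> = (\<integral>\<^sup>+\<omega>. \<integral>\<^sup>+p. f p \<partial>?Q \<omega> \<partial>M)"
    using Q by (intro nn_integral_bind[OF f measurable_prob_algebraD])
  also have "\<dots> = (\<integral>\<^sup>+\<omega>. \<integral>\<^sup>+s. f (Y \<omega>, s) \<partial>K (X k \<omega>) \<partial>M)"
    using PY by (intro nn_integral_cong) (simp add: nn_integral_distr)
  finally show ?thesis by (simp add: nn_integral_distr)
qed

text \<open>Induction on \<open>t\<close> for all \<open>f\<close> at once: the last transition is
  integrated out first, which replaces \<open>f\<close> by its kernel integral \<open>?g\<close>.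
  This is possible because \<open>Y\<close>, known at time \<open>k\<close>, is still known at time
  \<open>k + t\<close>.\<close>

lemma markov_chain_steps:
  assumes mc: "markov_chain M S K X" and Y: "Y \<in> past M S X k \<rightarrow>\<^sub>M N"
    and "f \<in> borel_measurable (N \<Otimes>\<^sub>M S)"
  shows "(\<integral>\<^sup>+\<omega>. f (Y \<omega>, X (k + t) \<omega>) \<partial>M)
    = (\<integral>\<^sup>+\<omega>. \<integral>\<^sup>+s. f (Y \<omega>, s) \<partial>kernel_power S K t (X k \<omega>) \<partial>M)"
  using assms(3)
proof (induction t arbitrary: f)
  have K[measurable]: "K \<in> S \<rightarrow>\<^sub>M prob_algebra S" and X: "\<And>k. X k \<in> M \<rightarrow>\<^sub>M S"
    using mc by (auto simp: markov_chain_def)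
  have Y': "Y \<in> M \<rightarrow>\<^sub>M N"
    using measurable_from_subalg[OF subalgebra_past[OF X] Y] .
  {
    case 0
    show ?case
    proof (intro nn_integral_cong)
      fix \<omega> assume \<omega>: "\<omega> \<in> space M"
      have "(\<lambda>s. f (Y \<omega>, s)) \<in> borel_measurable S"
        using 0 measurable_space[OF Y' \<omega>] by measurable
      then show "f (Y \<omega>, X (k + 0) \<omega>) = (\<integral>\<^sup>+s. f (Y \<omega>, s) \<partial>kernel_power S K 0 (X k \<omega>))"
        using measurable_space[OF X \<omega>] by (simp add: nn_integral_return)
    qed
  next
    case (Suc t)
    note [measurable] = Suc.prems
    let ?g = "\<lambda>(y, s'). \<integral>\<^sup>+s. f (y, s) \<partial>K s'"
    have "(\<integral>\<^sup>+\<omega>. f (Y \<omega>, X (k + Suc t) \<omega>) \<partial>M) = (\<integral>\<^sup>+\<omega>. ?g (Y \<omega>, X (k + t) \<omega>) \<partial>M)"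
      using markov_chain_step[OF mc measurable_past_mono[OF le_add1 Y] Suc.prems] by simp
    also have "\<dots> = (\<integral>\<^sup>+\<omega>. \<integral>\<^sup>+s. ?g (Y \<omega>, s) \<partial>kernel_power S K t (X k \<omega>) \<partial>M)"
    proof (rule Suc.IH)
      have "(\<lambda>p. \<integral>\<^sup>+s. f (fst p, s) \<partial>K (snd p)) \<in> borel_measurable (N \<Otimes>\<^sub>M S)"
        by (rule nn_integral_measurable_subprob_algebra2[where N = S])
          (use measurable_prob_algebraD[OF K] in measurable)
      then show "?g \<in> borel_measurable (N \<Otimes>\<^sub>M S)" by (simp add: split_beta')
    qed
    also have "\<dots> = (\<integral>\<^sup>+\<omega>. \<integral>\<^sup>+s. f (Y \<omega>, s) \<partial>kernel_power S K (Suc t) (X k \<omega>) \<partial>M)"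
    proof (rule nn_integral_cong)
      fix \<omega> assume \<omega>: "\<omega> \<in> space M"
      have *: "sets (kernel_power S K t (X k \<omega>)) = sets S"
        using measurable_space[OF measurable_kernel_power[OF K] measurable_space[OF X \<omega>]]
        by (auto simp: space_prob_algebra)
      have "(\<lambda>s. f (Y \<omega>, s)) \<in> borel_measurable S"
        using measurable_space[OF Y' \<omega>] by measurable
      moreover have "K \<in> kernel_power S K t (X k \<omega>) \<rightarrow>\<^sub>M subprob_algebra S"
        using measurable_prob_algebraD[OF K] * by (simp cong: measurable_cong_sets)
      ultimately show "(\<integral>\<^sup>+s. ?g (Y \<omega>, s) \<partial>kernel_power S K t (X k \<omega>))
          = (\<integral>\<^sup>+s. f (Y \<omega>, s) \<partial>kernel_power S K (Suc t) (X k \<omega>))"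
        by (simp add: nn_integral_bind)
    qed
    finally show ?case .
  }
qed

section \<open>Mixing for bounded test functions\<close>

text \<open>As \<open>h\<close> has mean zero, its integral against the law after \<open>t\<close>
  steps is the integral of \<open>(p - q) * h\<close>, hence at most the bound on \<open>h\<close>
  times the distance of the densities. \<open>C\<close> serves all \<open>t\<close>,
  \<open>x\<close> and \<open>h\<close> simultaneously.\<close>

lemma geometric_mixingE:
  assumes "geometric_mixing K \<pi> r" "prob_space \<pi>" "K \<in> \<pi> \<rightarrow>\<^sub>M prob_algebra \<pi>"
  obtains C where "C > 0"
    "\<And>t x (h :: _ \<Rightarrow> real) B. x \<in> space \<pi> \<Longrightarrow> h \<in> borel_measurable \<pi> \<Longrightarrow> (\<And>s. s \<in> space \<pi> \<Longrightarrow> \<bar>h s\<bar> \<le> B) \<Longrightarrow>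
      (\<integral>s. h s \<partial>\<pi>) = 0 \<Longrightarrow> (\<integral>s. h s \<partial>kernel_power \<pi> K t x) \<le> B * (C * r ^ t)"
proof -
  obtain C where C: "C > 0" and mix: "\<And>t x. x \<in> space \<pi> \<Longrightarrow> \<exists>\<mu> p q.
        sets \<mu> = sets \<pi> \<and>
        p \<in> borel_measurable \<mu> \<and> (\<forall>s. 0 \<le> p s) \<and>
        q \<in> borel_measurable \<mu> \<and> (\<forall>s. 0 \<le> q s) \<and>
        kernel_power \<pi> K t x = density \<mu> (\<lambda>s. ennreal (p s)) \<and>
        \<pi> = density \<mu> (\<lambda>s. ennreal (q s)) \<and>
        (\<integral>s. \<bar>p s - q s\<bar> \<partial>\<mu>) \<le> C * r ^ t"
    using assms(1) unfolding geometric_mixing_def by blast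
  have "(\<integral>s. h s \<partial>kernel_power \<pi> K t x) \<le> B * (C * r ^ t)"
    if x: "x \<in> space \<pi>" and h: "h \<in> borel_measurable \<pi>" and B: "\<And>s. s \<in> space \<pi> \<Longrightarrow> \<bar>h s\<bar> \<le> B"
      and zero: "(\<integral>s. h s \<partial>\<pi>) = 0" for t x and h :: "_ \<Rightarrow> real" and B
  proof -
    obtain \<mu> p q where sets: "sets \<mu> = sets \<pi>"
      and p[measurable]: "p \<in> borel_measurable \<mu>" and p0: "\<And>s. 0 \<le> p s"
      and q[measurable]: "q \<in> borel_measurable \<mu>" and q0: "\<And>s. 0 \<le> q s"
      and P: "kernel_power \<pi> K t x = density \<mu> (\<lambda>s. ennreal (p s))"
      and Q: "\<pi> = density \<mu> (\<lambda>s. ennreal (q s))"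
      and L1: "(\<integral>s. \<bar>p s - q s\<bar> \<partial>\<mu>) \<le> C * r ^ t"
      using mix[OF x, of t] by blast
    have h'[measurable]: "h \<in> borel_measurable \<mu>"
      using h sets by (simp cong: measurable_cong_sets)
    have space: "space \<mu> = space \<pi>" using sets by (rule sets_eq_imp_space_eq)
    \<comment> \<open>\<open>\<mu>\<close> itself may be infinite; integrability of
      \<open>p * h\<close> and \<open>q * h\<close> comes from \<open>p\<close> and \<open>q\<close>
      being probability densities and \<open>h\<close> being bounded.\<close>
    have dens: "integrable \<mu> d" if d[measurable]: "d \<in> borel_measurable \<mu>" and "\<And>s. 0 \<le> d s"
        and "prob_space (density \<mu> (\<lambda>s. ennreal (d s)))" for d :: "_ \<Rightarrow> real"
    proof (rule integrableI_nonneg)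
      interpret prob_space "density \<mu> (\<lambda>s. ennreal (d s))" by fact
      have "(\<integral>\<^sup>+s. ennreal (d s) \<partial>\<mu>) = 1"
        using emeasure_space_1 by (simp add: emeasure_density cong: nn_integral_cong)
      then show "(\<integral>\<^sup>+s. ennreal (d s) \<partial>\<mu>) < \<infinity>" by simp
    qed (use that in auto)
    have "prob_space (kernel_power \<pi> K t x)"
      using measurable_space[OF measurable_kernel_power[OF assms(3)] x] by (auto simp: space_prob_algebra)
    then have ip: "integrable \<mu> p" using p0 by (intro dens) (auto simp: P)
    have iq: "integrable \<mu> q" using q0 assms(2) Q by (intro dens) auto
    have ih: "integrable \<mu> (\<lambda>s. d s * h s)" if "integrable \<mu> d" for d :: "_ \<Rightarrow> real"
    proof (rule Bochner_Integration.integrable_bound)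
      show "integrable \<mu> (\<lambda>s. d s * B)" using that by simp
      show "AE s in \<mu>. norm (d s * h s) \<le> norm (d s * B)"
        using B by (auto simp: space abs_mult intro!: AE_I2 mult_left_mono order_trans[OF B abs_ge_self])
    qed (use that in measurable)
    have B0: "B \<ge> 0" using B[OF x] by linarith
    have "(\<integral>s. h s \<partial>kernel_power \<pi> K t x) = (\<integral>s. p s * h s \<partial>\<mu>)"
      unfolding P using p0 by (subst integral_density) auto
    also have "\<dots> = (\<integral>s. p s * h s \<partial>\<mu>) - (\<integral>s. q s * h s \<partial>\<mu>)"
      using zero q0 by (subst (asm) Q) (simp add: integral_density)
    also have "\<dots> = (\<integral>s. (p s - q s) * h s \<partial>\<mu>)"
      using ih[OF ip] ih[OF iq] by (simp add: left_diff_distrib)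
    also have "\<dots> \<le> (\<integral>s. B * \<bar>p s - q s\<bar> \<partial>\<mu>)"
    proof (rule integral_mono)
      fix s assume "s \<in> space \<mu>"
      then have "\<bar>p s - q s\<bar> * \<bar>h s\<bar> \<le> \<bar>p s - q s\<bar> * B" using B space by (intro mult_left_mono) auto
      then show "(p s - q s) * h s \<le> B * \<bar>p s - q s\<bar>"
        using abs_ge_self[of "(p s - q s) * h s"] by (simp add: abs_mult mult.commute)
    qed (use ip iq ih in auto)
    also have "\<dots> \<le> B * (C * r ^ t)"
      using L1 B0 by (simp add: mult_left_mono)
    finally show ?thesis .
  qed
  then show thesis by (rule that[OF C])
qed

text \<open>Conditioning on the past at time \<open>k\<close>: a bound on the kernel integral with
  \<open>Y\<close> frozen, uniform over sample points, passes to the expectation. The test function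
  \<open>u (Y \<omega>, _)\<close> may thus be random as long as it is known at time
  \<open>k\<close>.\<close>

lemma markov_chain_integral_le:
  fixes u :: "'b \<times> 's \<Rightarrow> real"
  assumes mc: "markov_chain M S K X" and Y: "Y \<in> past M S X k \<rightarrow>\<^sub>M N"
    and u[measurable]: "u \<in> borel_measurable (N \<Otimes>\<^sub>M S)"
    and bound: "\<And>\<omega> s. \<omega> \<in> space M \<Longrightarrow> s \<in> space S \<Longrightarrow> \<bar>u (Y \<omega>, s)\<bar> \<le> B"
    and le: "\<And>\<omega>. \<omega> \<in> space M \<Longrightarrow> (\<integral>s. u (Y \<omega>, s) \<partial>kernel_power S K t (X k \<omega>)) \<le> \<beta>"
  shows "(\<integral>\<omega>. u (Y \<omega>, X (k + t) \<omega>) \<partial>M) \<le> \<beta>"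
proof -
  interpret prob_space M using mc by (simp add: markov_chain_def)
  have K[measurable]: "K \<in> S \<rightarrow>\<^sub>M prob_algebra S" and X[measurable]: "\<And>k. X k \<in> M \<rightarrow>\<^sub>M S"
    using mc by (auto simp: markov_chain_def)
  have Y'[measurable]: "Y \<in> M \<rightarrow>\<^sub>M N"
    using measurable_from_subalg[OF subalgebra_past[OF X] Y] .
  have XS: "X j \<omega> \<in> space S" if "\<omega> \<in> space M" for j \<omega> using measurable_space[OF X that] .
  have int: "integrable M (\<lambda>\<omega>. u (Y \<omega>, X (k + t) \<omega>))"
    by (rule integrable_const_bound[where B = B]) (use bound XS in auto)
  \<comment> \<open>\<open>markov_chain_steps\<close> concerns nonnegative integrals, so
    \<open>u\<close> is shifted by its bound \<open>B\<close>. Nonnegativity of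
    \<open>\<beta> + B\<close> permits removing \<open>ennreal\<close> at the end.\<close>
  have inner: "(\<integral>\<^sup>+s. ennreal (u (Y \<omega>, s) + B) \<partial>kernel_power S K t (X k \<omega>)) \<le> ennreal (\<beta> + B)"
    "0 \<le> \<beta> + B" if \<omega>: "\<omega> \<in> space M" for \<omega>
  proof -
    let ?P = "kernel_power S K t (X k \<omega>)"
    have P: "sets ?P = sets S" "prob_space ?P"
      using measurable_space[OF measurable_kernel_power[OF K] XS[OF \<omega>]] by (auto simp: space_prob_algebra)
    interpret P: prob_space ?P by fact
    have sp: "space ?P = space S" using P(1) by (rule sets_eq_imp_space_eq)
    have "(\<lambda>s. u (Y \<omega>, s)) \<in> borel_measurable S"
      using measurable_space[OF Y' \<omega>] by measurable
    then have [measurable]: "(\<lambda>s. u (Y \<omega>, s)) \<in> borel_measurable ?P"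
      using P(1) by (simp cong: measurable_cong_sets)
    have i: "integrable ?P (\<lambda>s. u (Y \<omega>, s))"
      by (rule P.integrable_const_bound[where B = B]) (use bound[OF \<omega>] sp in auto)
    have nonneg: "0 \<le> u (Y \<omega>, s) + B" if "s \<in> space S" for s
      using bound[OF \<omega> that] by linarith
    have "(\<integral>\<^sup>+s. ennreal (u (Y \<omega>, s) + B) \<partial>?P) = ennreal (\<integral>s. u (Y \<omega>, s) + B \<partial>?P)"
      using i nonneg sp by (intro nn_integral_eq_integral) auto
    also have "(\<integral>s. u (Y \<omega>, s) + B \<partial>?P) = (\<integral>s. u (Y \<omega>, s) \<partial>?P) + B"
      using i by (simp add: P.prob_space)
    finally show "(\<integral>\<^sup>+s. ennreal (u (Y \<omega>, s) + B) \<partial>?P) \<le> ennreal (\<beta> + B)"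
      using le[OF \<omega>] by (simp add: ennreal_leI)
    have "0 \<le> (\<integral>s. u (Y \<omega>, s) + B \<partial>?P)"
      using nonneg sp by (intro integral_nonneg_AE) auto
    also have "\<dots> = (\<integral>s. u (Y \<omega>, s) \<partial>?P) + B"
      using i by (simp add: P.prob_space)
    finally show "0 \<le> \<beta> + B" using le[OF \<omega>] by linarith
  qed
  have "ennreal (\<integral>\<omega>. u (Y \<omega>, X (k + t) \<omega>) + B \<partial>M) = (\<integral>\<^sup>+\<omega>. ennreal (u (Y \<omega>, X (k + t) \<omega>) + B) \<partial>M)"
  proof (intro nn_integral_eq_integral[symmetric] AE_I2)
    fix \<omega> assume "\<omega> \<in> space M"
    from bound[OF this XS[OF this, of "k + t"]] show "0 \<le> u (Y \<omega>, X (k + t) \<omega>) + B" by linarith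
  qed (use int in simp)
  also have "\<dots> = (\<integral>\<^sup>+\<omega>. \<integral>\<^sup>+s. ennreal (u (Y \<omega>, s) + B) \<partial>kernel_power S K t (X k \<omega>) \<partial>M)"
    by (rule markov_chain_steps[OF mc Y, of "\<lambda>p. ennreal (u p + B)"]) measurable
  also have "\<dots> \<le> (\<integral>\<^sup>+\<omega>. ennreal (\<beta> + B) \<partial>M)"
    by (rule nn_integral_mono) (rule inner)
  also have "\<dots> = ennreal (\<beta> + B)" by (simp add: emeasure_space_1)
  finally have "(\<integral>\<omega>. u (Y \<omega>, X (k + t) \<omega>) + B \<partial>M) \<le> \<beta> + B"
    using inner(2) not_empty by (metis ennreal_le_iff ex_in_conv)
  then show ?thesis using int by (simp add: prob_space)
qed

section \<open>Series and real sequences\<close>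

text \<open>Up to the nonnegative term \<open>j = k\<close>, this is the Cauchy product of
  \<open>c\<close> with the geometric series, both absolutely convergent.\<close>

lemma summable_geometric_convolution:
  fixes c :: "nat \<Rightarrow> real"
  assumes "summable c" "\<And>k. c k \<ge> 0" "0 < r" "r < 1"
  shows "summable (\<lambda>k. \<Sum>j<k. r ^ (k - j) * c j)"
proof (rule summable_comparison_test')
  show "summable (\<lambda>k. \<Sum>i\<le>k. c i * r ^ (k - i))"
    by (rule summable_Cauchy_product) (use assms in \<open>auto simp: power_abs\<close>)
  fix k
  have "(\<Sum>j<k. r ^ (k - j) * c j) \<le> (\<Sum>j\<le>k. r ^ (k - j) * c j)"
    using assms by (intro sum_mono2) auto
  moreover have "0 \<le> (\<Sum>j<k. r ^ (k - j) * c j)"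
    using assms by (intro sum_nonneg) auto
  ultimately show "norm (\<Sum>j<k. r ^ (k - j) * c j) \<le> (\<Sum>i\<le>k. c i * r ^ (k - i))"
    by (simp add: mult.commute)
qed

text \<open>
  The increments of the cubes \<open>b\<^sup>3\<close> are absolutely summable, so \<open>b\<^sup>3\<close> converges; this avoids the
  usual upcrossing argument.
\<close>

lemma tendsto_zero_of_weighted_square_summable:
  fixes b \<gamma> \<epsilon> :: "nat \<Rightarrow> real"
  assumes b: "\<And>k. 0 \<le> b k" "\<And>k. b k \<le> D"
    and incr: "\<And>k. \<bar>b (Suc k) - b k\<bar> \<le> c * \<gamma> k + \<epsilon> k"
    and nonneg: "0 \<le> c" "\<And>k. 0 \<le> \<gamma> k" "\<And>k. 0 \<le> \<epsilon> k"
    and sumb: "summable (\<lambda>k. \<gamma> k * (b k)\<^sup>2)" and sum2: "summable (\<lambda>k. (\<gamma> k)\<^sup>2)"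
    and sume: "summable \<epsilon>" and div: "\<not> summable \<gamma>"
  shows "b \<longlonglongrightarrow> 0"
proof -
  have D0: "0 \<le> D" using b[of 0] by linarith
  \<comment> \<open>To leading order an increment of the cube is \<open>3 * (b k)^2\<close> times an
    increment of \<open>b\<close>. The third power makes the part \<open>c * \<gamma> k\<close> of
    the latter meet the summable \<open>\<gamma> k * (b k)^2\<close>. The constants of the majorant
    come from five times estimate \<open>1\<close> plus three times estimate
    \<open>2\<close>.\<close>
  have "summable (\<lambda>k. b (Suc k) ^ 3 - b k ^ 3)"
  proof (rule summable_comparison_test')
    show "summable (\<lambda>k. 5 * c * (\<gamma> k * (b k)\<^sup>2) + 11 * D\<^sup>2 * \<epsilon> k + 3 * D * c\<^sup>2 * (\<gamma> k)\<^sup>2)"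
      by (intro summable_add summable_mult sumb sum2 sume)
    fix k
    define d where "d = \<bar>b (Suc k) - b k\<bar>"
    have d: "0 \<le> d" "d \<le> D" "d \<le> c * \<gamma> k + \<epsilon> k"
      using incr[of k] b[of k] b[of "Suc k"] by (auto simp: d_def)
    \<comment> \<open>Only against \<open>\<epsilon> k\<close> is \<open>d\<close> replaced by
      \<open>D\<close>; the product with \<open>c * \<gamma> k\<close> keeps it and is absorbed by
      the AM-GM inequality, so \<open>\<gamma> k\<close> enters \<open>d2\<close> squared.\<close>
    have "d * d \<le> d * (c * \<gamma> k) + D * \<epsilon> k"
      using mult_left_mono[OF d(3) d(1)] mult_right_mono[OF d(2) nonneg(3)[of k]]
      by (simp add: distrib_left)
    moreover have "2 * (d * (c * \<gamma> k)) \<le> d\<^sup>2 + (c * \<gamma> k)\<^sup>2"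
      using sum_squares_bound[of d "c * \<gamma> k"] by simp
    ultimately have d2: "d\<^sup>2 \<le> c\<^sup>2 * (\<gamma> k)\<^sup>2 + 2 * D * \<epsilon> k"
      by (simp add: power2_eq_square algebra_simps)
    have "d * (b k)\<^sup>2 \<le> (c * \<gamma> k + \<epsilon> k) * (b k)\<^sup>2"
      using d by (intro mult_right_mono) auto
    also have "\<dots> \<le> c * \<gamma> k * (b k)\<^sup>2 + D\<^sup>2 * \<epsilon> k"
      using mult_left_mono[OF power_mono[OF b(2) b(1), of k 2] nonneg(3)[of k]]
      by (simp add: algebra_simps)
    finally have 1: "d * (b k)\<^sup>2 \<le> c * \<gamma> k * (b k)\<^sup>2 + D\<^sup>2 * \<epsilon> k" .
    have "d * d\<^sup>2 \<le> D * d\<^sup>2" using d by (intro mult_right_mono) auto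
    also have "\<dots> \<le> D * (c\<^sup>2 * (\<gamma> k)\<^sup>2 + 2 * D * \<epsilon> k)"
      using d2 D0 by (rule mult_left_mono)
    finally have 2: "d * d\<^sup>2 \<le> D * c\<^sup>2 * (\<gamma> k)\<^sup>2 + 2 * D\<^sup>2 * \<epsilon> k"
      by (simp add: power2_eq_square algebra_simps)
    have "b (Suc k) ^ 3 - b k ^ 3
        = (b (Suc k) - b k) * ((b (Suc k))\<^sup>2 + b (Suc k) * b k + (b k)\<^sup>2)"
      by (simp add: power2_eq_square power3_eq_cube algebra_simps)
    then have "\<bar>b (Suc k) ^ 3 - b k ^ 3\<bar> = d * ((b (Suc k))\<^sup>2 + b (Suc k) * b k + (b k)\<^sup>2)"
      using b by (simp add: abs_mult d_def)
    also have "\<dots> \<le> d * (5 * (b k)\<^sup>2 + 3 * d\<^sup>2)"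
    proof (rule mult_left_mono)
      \<comment> \<open>Completed square for
        \<open>2 * (b (Suc k))^2 - 7 * b (Suc k) * b k + 7 * (b k)^2\<close>, the difference of the
        two sides.\<close>
      have "0 \<le> 2 * (b (Suc k) - 7 / 4 * b k)\<^sup>2 + 7 / 8 * (b k)\<^sup>2" by simp
      then show "(b (Suc k))\<^sup>2 + b (Suc k) * b k + (b k)\<^sup>2 \<le> 5 * (b k)\<^sup>2 + 3 * d\<^sup>2"
        unfolding d_def power2_abs by (simp add: power2_eq_square algebra_simps)
    qed (rule d)
    also have "\<dots> = 5 * (d * (b k)\<^sup>2) + 3 * (d * d\<^sup>2)" by (simp add: algebra_simps)
    also have "\<dots> \<le> 5 * c * (\<gamma> k * (b k)\<^sup>2) + 11 * D\<^sup>2 * \<epsilon> k + 3 * D * c\<^sup>2 * (\<gamma> k)\<^sup>2"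
      using 1 2 by (simp add: algebra_simps)
    finally show "norm (b (Suc k) ^ 3 - b k ^ 3)
        \<le> 5 * c * (\<gamma> k * (b k)\<^sup>2) + 11 * D\<^sup>2 * \<epsilon> k + 3 * D * c\<^sup>2 * (\<gamma> k)\<^sup>2" by simp
  qed
  then have "convergent (\<lambda>n. \<Sum>k<n. b (Suc k) ^ 3 - b k ^ 3)"
    by (simp add: summable_iff_convergent)
  from convergent_add[OF this convergent_const[of "b 0 ^ 3"]]
  have "convergent (\<lambda>n. b n ^ 3)"
    using sum_lessThan_telescope[of "\<lambda>k. b k ^ 3"] by simp
  then obtain l where l: "(\<lambda>n. b n ^ 3) \<longlonglongrightarrow> l" by (auto simp: convergent_def)
  have "(\<lambda>n. root 3 (b n ^ 3)) \<longlonglongrightarrow> root 3 l" by (rule tendsto_real_root[OF l])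
  then have lim: "b \<longlonglongrightarrow> root 3 l" by (simp add: odd_real_root_power_cancel)
  \<comment> \<open>A positive limit would keep \<open>b\<close> above half of it eventually, making
    \<open>\<gamma>\<close> dominated by a multiple of \<open>\<gamma> k * (b k)^2\<close>, against
    divergence.\<close>
  have "root 3 l = 0"
  proof (rule ccontr)
    assume "root 3 l \<noteq> 0"
    moreover have "root 3 l \<ge> 0" using lim b(1) by (intro LIMSEQ_le_const) auto
    ultimately have pos: "root 3 l > 0" by simp
    let ?h = "root 3 l / 2"
    have "eventually (\<lambda>k. b k > ?h) sequentially"
      using lim pos by (intro order_tendstoD) auto
    then obtain N where N: "\<And>k. k \<ge> N \<Longrightarrow> b k > ?h" by (auto simp: eventually_sequentially)
    have "summable \<gamma>"
    proof (rule summable_comparison_test'[where N = N])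
      show "summable (\<lambda>k. (1 / ?h\<^sup>2) * (\<gamma> k * (b k)\<^sup>2))" by (rule summable_mult[OF sumb])
      fix k assume "N \<le> k"
      then have "?h\<^sup>2 \<le> (b k)\<^sup>2" using N[of k] pos by (intro power_mono) auto
      then have "\<gamma> k * ?h\<^sup>2 \<le> \<gamma> k * (b k)\<^sup>2" using nonneg by (intro mult_left_mono) auto
      then show "norm (\<gamma> k) \<le> (1 / ?h\<^sup>2) * (\<gamma> k * (b k)\<^sup>2)"
        using pos nonneg(2)[of k] by (simp add: field_simps)
    qed
    with div show False ..
  qed
  with lim show ?thesis by simp
qed

lemma summable_power2_of_summable:
  fixes a :: "nat \<Rightarrow> real"
  assumes "summable a" "\<And>k. 0 \<le> a k"
  shows "summable (\<lambda>k. (a k)\<^sup>2)"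
proof (rule summable_comparison_test_ev[OF _ assms(1)])
  have "eventually (\<lambda>k. a k < 1) sequentially"
    using summable_LIMSEQ_zero[OF assms(1)] by (rule order_tendstoD) simp
  then show "eventually (\<lambda>k. norm ((a k)\<^sup>2) \<le> a k) sequentially"
    by eventually_elim (use assms(2) in \<open>simp add: power2_eq_square mult_left_le\<close>)
qed

text \<open>Comparison with the weighted series from \<open>k = 2\<close> on: there
  \<open>Suc k\<close> is at least 3, which exceeds \<open>exp 1\<close>, so the weight is at least
  1.\<close>

lemma summable_of_log_weighted:
  fixes a :: "nat \<Rightarrow> real"
  assumes "summable (\<lambda>k. (ln (real (Suc k)))\<^sup>2 * a (Suc k))" "\<And>k. 0 \<le> a k"
  shows "summable a"
proof -
  have "summable (\<lambda>k. a (Suc k))"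
  proof (rule summable_comparison_test'[OF assms(1), of 2])
    fix k :: nat assume k: "2 \<le> k"
    have "exp 1 \<le> real (Suc k)" using exp_le k by linarith
    then have "1 \<le> ln (real (Suc k))" by (simp add: ln_ge_iff)
    then have "1 * a (Suc k) \<le> (ln (real (Suc k)))\<^sup>2 * a (Suc k)"
      using assms(2) by (intro mult_right_mono) auto
    then show "norm (a (Suc k)) \<le> (ln (real (Suc k)))\<^sup>2 * a (Suc k)"
      using assms(2)[of "Suc k"] by simp
  qed
  then show ?thesis by (simp add: summable_Suc_iff)
qed

section \<open>Adapted iterates and the Markovian noise\<close>

text \<open>The iterate \<open>x (Suc k)\<close> is computed from the states up to time
  \<open>k\<close>, so it is known one step early. The second conclusion records this; it lets the
  increment from \<open>x j\<close> to \<open>x (Suc j)\<close> be frozen at time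
  \<open>j\<close>.\<close>

lemma markov_recursion_measurable_past:
  assumes X: "\<And>k. X k \<in> M \<rightarrow>\<^sub>M S"
    and H: "\<And>k. (\<lambda>(y, s). H k y s) \<in> N \<Otimes>\<^sub>M S \<rightarrow>\<^sub>M N"
    and x0: "\<And>\<omega>. \<omega> \<in> space M \<Longrightarrow> x 0 \<omega> = x0" "x0 \<in> space N"
    and step: "\<And>k \<omega>. \<omega> \<in> space M \<Longrightarrow> x (Suc k) \<omega> = H k (x k \<omega>) (X k \<omega>)"
  shows "x k \<in> past M S X k \<rightarrow>\<^sub>M N" "x (Suc k) \<in> past M S X k \<rightarrow>\<^sub>M N"
proof -
  have S: "x (Suc k) \<in> past M S X k \<rightarrow>\<^sub>M N" if "x k \<in> past M S X k \<rightarrow>\<^sub>M N" for k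
  proof -
    have "(\<lambda>\<omega>. (x k \<omega>, X k \<omega>)) \<in> past M S X k \<rightarrow>\<^sub>M N \<Otimes>\<^sub>M S"
      using that measurable_past_process[OF X order_refl[of k]] by (rule measurable_Pair)
    from measurable_compose[OF this H[of k]]
    have "(\<lambda>\<omega>. H k (x k \<omega>) (X k \<omega>)) \<in> past M S X k \<rightarrow>\<^sub>M N" by simp
    then show ?thesis
      using step by (subst measurable_cong[where g = "\<lambda>\<omega>. H k (x k \<omega>) (X k \<omega>)"]) auto
  qed
  have "x k \<in> past M S X k \<rightarrow>\<^sub>M N" for k
  proof (induction k)
    case 0
    have "(\<lambda>_. x0) \<in> past M S X 0 \<rightarrow>\<^sub>M N" using x0(2) by simp
    then show ?case
      using x0(1) by (subst measurable_cong[where g = "\<lambda>_. x0"]) auto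
  next
    case (Suc k)
    then show ?case using S by (intro measurable_past_mono[of k "Suc k"]) auto
  qed
  with S show "x k \<in> past M S X k \<rightarrow>\<^sub>M N" "x (Suc k) \<in> past M S X k \<rightarrow>\<^sub>M N" by auto
qed

text \<open>
  Telescoping over the time at which the iterate is frozen: \<open>\<phi> (x (Suc j)) - \<phi> (x j)\<close> is of size
  \<open>a j\<close>, depends on the past at time \<open>j\<close> only, and has mean zero, so after \<open>k - j\<close> steps of the
  chain its conditional expectation has shrunk by the factor \<open>r ^ (k - j)\<close>.
\<close>

lemma markov_noise_bound:
  fixes \<phi> :: "'a::{metric_space, second_countable_topology} \<Rightarrow> 's \<Rightarrow> real"
  assumes mc: "markov_chain M S K X"
    and mix: "\<And>t z (h :: 's \<Rightarrow> real) B. z \<in> space S \<Longrightarrow> h \<in> borel_measurable S \<Longrightarrow>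
      (\<And>s. s \<in> space S \<Longrightarrow> \<bar>h s\<bar> \<le> B) \<Longrightarrow> (\<integral>s. h s \<partial>S) = 0 \<Longrightarrow>
      (\<integral>s. h s \<partial>kernel_power S K t z) \<le> B * (C * r ^ t)"
    and H: "\<And>k. (\<lambda>(y, s). H k y s) \<in> borel \<Otimes>\<^sub>M S \<rightarrow>\<^sub>M borel"
    and x0: "\<And>\<omega>. \<omega> \<in> space M \<Longrightarrow> x 0 \<omega> = x0"
    and step: "\<And>k \<omega>. \<omega> \<in> space M \<Longrightarrow> x (Suc k) \<omega> = H k (x k \<omega>) (X k \<omega>)"
    and a: "\<And>k \<omega>. \<omega> \<in> space M \<Longrightarrow> dist (x (Suc k) \<omega>) (x k \<omega>) \<le> a k"
    and \<phi>: "(\<lambda>(y, s). \<phi> y s) \<in> borel_measurable (borel \<Otimes>\<^sub>M S)"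
    and int: "\<And>y. integrable S (\<phi> y)" and zero: "\<And>y. (\<integral>s. \<phi> y s \<partial>S) = 0"
    and bound: "\<And>y s. s \<in> space S \<Longrightarrow> \<bar>\<phi> y s\<bar> \<le> B"
    and lip: "\<And>y z s. s \<in> space S \<Longrightarrow> \<bar>\<phi> y s - \<phi> z s\<bar> \<le> \<Lambda> * dist y z" and "0 \<le> \<Lambda>"
  shows "(\<integral>\<omega>. \<phi> (x k \<omega>) (X k \<omega>) \<partial>M) \<le> B * (C * r ^ k) + (\<Sum>j<k. \<Lambda> * a j * (C * r ^ (k - j)))"
proof -
  interpret prob_space M using mc by (simp add: markov_chain_def)
  have X[measurable]: "\<And>k. X k \<in> M \<rightarrow>\<^sub>M S"
    using mc by (auto simp: markov_chain_def)
  have past: "x k \<in> past M S X k \<rightarrow>\<^sub>M borel" "x (Suc k) \<in> past M S X k \<rightarrow>\<^sub>M borel" for k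
    by (rule markov_recursion_measurable_past[where H = H and ?x0.0 = x0, OF X H x0 _ step]; simp)+
  have x[measurable]: "x k \<in> borel_measurable M" for k
    using measurable_from_subalg[OF subalgebra_past[OF X] past(1)] by blast
  have \<phi>_compose[measurable (raw)]: "(\<lambda>w. \<phi> (p w) (q w)) \<in> borel_measurable W"
    if "p \<in> W \<rightarrow>\<^sub>M borel" "q \<in> W \<rightarrow>\<^sub>M S" for p q W
    using measurable_compose[OF measurable_Pair[OF that] \<phi>] by simp
  have \<phi>_compose_pair[measurable (raw)]: "(\<lambda>w. \<phi> (p w) (q w)) \<in> borel_measurable W"
    if "p \<in> W \<rightarrow>\<^sub>M borel" "q \<in> W \<rightarrow>\<^sub>M S" for p q and W :: "(('a \<times> 'a) \<times> 's) measure"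
    using measurable_compose[OF measurable_Pair[OF that] \<phi>] by simp
  have XS: "X j \<omega> \<in> space S" if "\<omega> \<in> space M" for j \<omega> using measurable_space[OF X that] .
  have I: "integrable M (\<lambda>\<omega>. \<phi> (x j \<omega>) (X k \<omega>))" for j
    using bound XS by (intro integrable_const_bound[where B = B]) auto
  \<comment> \<open>The telescoped sum starts at \<open>x 0\<close>, known at time 0, so all
    \<open>k\<close> transitions contribute to the decay.\<close>
  have base: "(\<integral>\<omega>. \<phi> (x 0 \<omega>) (X k \<omega>) \<partial>M) \<le> B * (C * r ^ k)"
  proof -
    have "(\<integral>\<omega>. (\<lambda>p. \<phi> (fst p) (snd p)) (x 0 \<omega>, X (0 + k) \<omega>) \<partial>M) \<le> B * (C * r ^ k)"
    proof (rule markov_chain_integral_le[OF mc past(1)])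
      show "(\<lambda>p. \<phi> (fst p) (snd p)) \<in> borel_measurable (borel \<Otimes>\<^sub>M S)"
        using \<phi> by (simp add: split_beta')
      fix \<omega> assume \<omega>: "\<omega> \<in> space M"
      show "(\<integral>s. \<phi> (fst (x 0 \<omega>, s)) (snd (x 0 \<omega>, s)) \<partial>kernel_power S K k (X 0 \<omega>)) \<le> B * (C * r ^ k)"
        unfolding fst_conv snd_conv
        using int zero bound by (intro mix XS[OF \<omega>]) auto
    qed (use bound in auto)
    then show ?thesis by simp
  qed
  have incr: "(\<integral>\<omega>. \<phi> (x (Suc j) \<omega>) (X k \<omega>) - \<phi> (x j \<omega>) (X k \<omega>) \<partial>M) \<le> \<Lambda> * a j * (C * r ^ (k - j))"
    if "j < k" for j
  proof -
    let ?u = "\<lambda>p. \<phi> (snd (fst p)) (snd p) - \<phi> (fst (fst p)) (snd p)"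
    have le: "\<bar>\<phi> (x (Suc j) \<omega>) s - \<phi> (x j \<omega>) s\<bar> \<le> \<Lambda> * a j" if "\<omega> \<in> space M" "s \<in> space S" for \<omega> s
      using lip[OF that(2)] mult_left_mono[OF a[OF that(1), of j] \<open>0 \<le> \<Lambda>\<close>] by (rule order_trans)
    have "(\<integral>\<omega>. ?u ((x j \<omega>, x (Suc j) \<omega>), X (j + (k - j)) \<omega>) \<partial>M) \<le> \<Lambda> * a j * (C * r ^ (k - j))"
    proof (rule markov_chain_integral_le[OF mc])
      show "(\<lambda>\<omega>. (x j \<omega>, x (Suc j) \<omega>)) \<in> past M S X j \<rightarrow>\<^sub>M borel \<Otimes>\<^sub>M borel"
        by (intro measurable_Pair past)
      show "?u \<in> borel_measurable ((borel \<Otimes>\<^sub>M borel) \<Otimes>\<^sub>M S)"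
        by measurable
      fix \<omega> assume \<omega>: "\<omega> \<in> space M"
      show "(\<integral>s. ?u ((x j \<omega>, x (Suc j) \<omega>), s) \<partial>kernel_power S K (k - j) (X j \<omega>)) \<le> \<Lambda> * a j * (C * r ^ (k - j))"
        unfolding fst_conv snd_conv
        using int zero le[OF \<omega>] by (intro mix XS[OF \<omega>]) auto
    qed (use le in auto)
    then show ?thesis using that by simp
  qed
  have "(\<integral>\<omega>. \<phi> (x k \<omega>) (X k \<omega>) \<partial>M)
      = (\<integral>\<omega>. \<phi> (x 0 \<omega>) (X k \<omega>) + (\<Sum>j<k. \<phi> (x (Suc j) \<omega>) (X k \<omega>) - \<phi> (x j \<omega>) (X k \<omega>)) \<partial>M)"
    by (subst sum_lessThan_telescope) simp
  also have "\<dots> = (\<integral>\<omega>. \<phi> (x 0 \<omega>) (X k \<omega>) \<partial>M)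
      + (\<Sum>j<k. \<integral>\<omega>. \<phi> (x (Suc j) \<omega>) (X k \<omega>) - \<phi> (x j \<omega>) (X k \<omega>) \<partial>M)"
    using I by (subst Bochner_Integration.integral_add) (auto intro!: Bochner_Integration.integral_sum)
  also have "\<dots> \<le> B * (C * r ^ k) + (\<Sum>j<k. \<Lambda> * a j * (C * r ^ (k - j)))"
    by (intro add_mono base sum_mono incr) simp
  finally show ?thesis .
qed

section \<open>Gradient descent driven by a Markov chain\<close>

text \<open>The setting in terms of gradients: \<open>g\<close> is the sampled gradient field,
  \<open>f\<close> the mean objective whose gradient is the mean of \<open>g\<close>,
  \<open>D\<close> a uniform gradient bound and \<open>fmin\<close> a lower bound of
  \<open>f\<close>.\<close>

locale markov_sgd = S: prob_space S for S :: "'s measure" +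
  fixes M :: "'w measure" and K :: "'s \<Rightarrow> 's measure" and X :: "nat \<Rightarrow> 'w \<Rightarrow> 's"
    and r D L fmin :: real and f :: "'a::euclidean_space \<Rightarrow> real" and g :: "'a \<Rightarrow> 's \<Rightarrow> 'a"
    and \<gamma> :: "nat \<Rightarrow> real" and e :: "nat \<Rightarrow> 'a" and x :: "nat \<Rightarrow> 'w \<Rightarrow> 'a" and x0 :: 'a
  assumes mc: "markov_chain M S K X" and mixing: "geometric_mixing K S r" and r: "0 < r" "r < 1"
    and gm: "\<And>y. g y \<in> borel_measurable S"
    and gb: "\<And>y s. s \<in> space S \<Longrightarrow> norm (g y s) \<le> D"
    and gl: "\<And>y z s. s \<in> space S \<Longrightarrow> norm (g y s - g z s) \<le> L * norm (y - z)" and L0: "0 \<le> L"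
    and f: "\<And>y. GDERIV f y :> (\<integral>s. g y s \<partial>S)" and fmin: "\<And>y. fmin \<le> f y"
    and \<gamma>: "\<And>k. 0 < \<gamma> k" "summable (\<lambda>k. (\<gamma> k)\<^sup>2)" and e: "summable (\<lambda>k. \<gamma> k * norm (e k))"
    and x0: "\<And>\<omega>. \<omega> \<in> space M \<Longrightarrow> x 0 \<omega> = x0"
    and step: "\<And>k \<omega>. \<omega> \<in> space M \<Longrightarrow> x (Suc k) \<omega> = x k \<omega> - \<gamma> k *\<^sub>R (g (x k \<omega>) (X k \<omega>) + e k)"
begin

sublocale M: prob_space M
  using mc by (simp add: markov_chain_def)

definition G :: "'a \<Rightarrow> 'a" where "G y = (\<integral>s. g y s \<partial>S)"

text \<open>One update as a function of iterate and state, the shape in which adaptedness of the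
  recursion is proved.\<close>

definition H :: "nat \<Rightarrow> 'a \<Rightarrow> 's \<Rightarrow> 'a" where "H k y s = y - \<gamma> k *\<^sub>R (g y s + e k)"

text \<open>A deterministic majorant of the length of step \<open>k\<close>.\<close>

definition a :: "nat \<Rightarrow> real" where "a k = D * \<gamma> k + \<gamma> k * norm (e k)"

text \<open>The decrease lost by moving along the sampled gradient:
  \<open>inner (G y) (g y s)\<close> is \<open>(norm (G y))^2 - \<phi> y s\<close>.\<close>

definition \<phi> :: "'a \<Rightarrow> 's \<Rightarrow> real" where "\<phi> y s = inner (G y) (G y - g y s)"

lemma K_measurable: "K \<in> S \<rightarrow>\<^sub>M prob_algebra S" and X_measurable [measurable]: "\<And>k. X k \<in> M \<rightarrow>\<^sub>M S"
  using mc by (auto simp: markov_chain_def)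

lemma X_in_space: "\<omega> \<in> space M \<Longrightarrow> X j \<omega> \<in> space S"
  using measurable_space[OF X_measurable] .

lemma g_integrable: "integrable S (g y)"
  by (rule S.integrable_const_bound[where B = D]) (use gb gm in auto)

lemma D_nonneg: "0 \<le> D"
  using gb S.not_empty by (meson ex_in_conv norm_ge_zero order_trans)

lemma norm_G_le: "norm (G y) \<le> D"
proof -
  have "norm (G y) \<le> (\<integral>s. norm (g y s) \<partial>S)" unfolding G_def by (rule integral_norm_bound)
  also have "\<dots> \<le> D" using g_integrable gb by (intro S.integral_le_const) auto
  finally show ?thesis .
qed

lemma G_lipschitz: "norm (G y - G z) \<le> L * norm (y - z)"
proof -
  have "norm (G y - G z) = norm (\<integral>s. g y s - g z s \<partial>S)"
    using g_integrable by (simp add: G_def)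
  also have "\<dots> \<le> (\<integral>s. norm (g y s - g z s) \<partial>S)" by (rule integral_norm_bound)
  also have "\<dots> \<le> L * norm (y - z)" using g_integrable gl by (intro S.integral_le_const) auto
  finally show ?thesis .
qed

lemma continuous_on_lipschitz:
  assumes "\<And>y z. norm (h y - h z) \<le> L * norm (y - z)"
  shows "continuous_on UNIV (h :: 'a \<Rightarrow> 'a)"
  by (rule lipschitz_on_continuous_on[of L]) (use assms L0 in \<open>auto intro!: lipschitz_onI simp: dist_norm\<close>)

lemma G_measurable [measurable]: "G \<in> borel_measurable borel"
  by (intro borel_measurable_continuous_onI continuous_on_lipschitz G_lipschitz)

lemma g_measurable [measurable]: "(\<lambda>p. g (fst p) (snd p)) \<in> borel_measurable (borel \<Otimes>\<^sub>M S)"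
  using borel_measurable_caratheodory[of g S, OF gm continuous_on_lipschitz, OF gl]
  by (simp add: split_beta')

lemma H_measurable: "(\<lambda>(y, s). H k y s) \<in> borel \<Otimes>\<^sub>M S \<rightarrow>\<^sub>M borel"
  unfolding split_beta' H_def by measurable

lemma x_measurable [measurable]: "x k \<in> borel_measurable M"
proof (rule measurable_from_subalg[OF subalgebra_past[OF X_measurable]])
  show "x k \<in> borel_measurable (past M S X k)"
    by (rule markov_recursion_measurable_past(1)[where H = H and ?x0.0 = x0])
      (use X_measurable H_measurable x0 step in \<open>auto simp: H_def\<close>)
qed

lemma norm_step_le: "norm (x (Suc k) \<omega> - x k \<omega>) \<le> a k" if \<omega>: "\<omega> \<in> space M"
proof -
  have "norm (x (Suc k) \<omega> - x k \<omega>) = \<gamma> k * norm (g (x k \<omega>) (X k \<omega>) + e k)"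
    using \<gamma>(1)[of k] by (simp add: step[OF \<omega>])
  also have "\<dots> \<le> \<gamma> k * (D + norm (e k))"
    using \<gamma>(1)[of k] gb[OF X_in_space[OF \<omega>, of k]]
    by (intro mult_left_mono norm_triangle_le add_right_mono) auto
  finally show ?thesis by (simp add: a_def algebra_simps)
qed

lemma \<phi>_measurable: "(\<lambda>(y, s). \<phi> y s) \<in> borel_measurable (borel \<Otimes>\<^sub>M S)"
  unfolding split_beta' \<phi>_def by measurable

lemma norm_G_diff_le: "s \<in> space S \<Longrightarrow> norm (G y - g y s) \<le> 2 * D"
  using norm_triangle_ineq4[of "G y" "g y s"] norm_G_le[of y] gb[of s y] by linarith

lemma abs_\<phi>_le: "\<bar>\<phi> y s\<bar> \<le> 2 * D\<^sup>2" if "s \<in> space S"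
proof -
  have "\<bar>\<phi> y s\<bar> \<le> norm (G y) * norm (G y - g y s)"
    unfolding \<phi>_def by (rule Cauchy_Schwarz_ineq2)
  also have "\<dots> \<le> D * (2 * D)"
    using norm_G_diff_le[OF that] D_nonneg by (intro mult_mono norm_G_le) auto
  finally show ?thesis by (simp add: power2_eq_square)
qed

text \<open>Product rule for the inner product: the factors are bounded by \<open>D\<close> and
  \<open>2 * D\<close> and have Lipschitz constants \<open>L\<close> and \<open>2 * L\<close>, so
  each of the two terms contributes \<open>2 * D * L\<close>.\<close>

lemma \<phi>_lipschitz: "\<bar>\<phi> y s - \<phi> z s\<bar> \<le> 4 * D * L * dist y z" if s: "s \<in> space S"
proof -
  have "\<phi> y s - \<phi> z s = inner (G y - G z) (G y - g y s) + inner (G z) ((G y - G z) - (g y s - g z s))"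
    by (simp add: \<phi>_def inner_diff_left inner_diff_right)
  also have "\<bar>\<dots>\<bar> \<le> norm (G y - G z) * norm (G y - g y s)
      + norm (G z) * norm ((G y - G z) - (g y s - g z s))"
    by (intro order_trans[OF abs_triangle_ineq] add_mono Cauchy_Schwarz_ineq2)
  also have "\<dots> \<le> (L * norm (y - z)) * (2 * D) + D * (L * norm (y - z) + L * norm (y - z))"
  proof (intro add_mono mult_mono G_lipschitz norm_G_le norm_G_diff_le[OF s])
    show "norm ((G y - G z) - (g y s - g z s)) \<le> L * norm (y - z) + L * norm (y - z)"
      by (rule order_trans[OF norm_triangle_ineq4 add_mono[OF G_lipschitz gl[OF s]]])
  qed (use D_nonneg L0 in auto)
  finally show ?thesis by (simp add: dist_norm algebra_simps)
qed

lemma \<phi>_integrable: "integrable S (\<phi> y)"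
  unfolding \<phi>_def using g_integrable by auto

lemma \<phi>_mean_zero: "(\<integral>s. \<phi> y s \<partial>S) = 0"
  unfolding \<phi>_def using g_integrable[of y] by (simp add: G_def[symmetric] S.prob_space)

lemma G_integrable: "integrable M (\<lambda>\<omega>. norm (G (x k \<omega>)))"
  by (rule M.integrable_const_bound[where B = D]) (use norm_G_le in auto)

lemma G_square_integrable: "integrable M (\<lambda>\<omega>. (norm (G (x k \<omega>)))\<^sup>2)"
proof (rule M.integrable_const_bound[where B = "D\<^sup>2"])
  show "AE \<omega> in M. norm ((norm (G (x k \<omega>)))\<^sup>2) \<le> D\<^sup>2"
    using norm_G_le by (auto intro!: power_mono)
qed measurable

lemma \<phi>_integrable_trajectory: "integrable M (\<lambda>\<omega>. \<phi> (x k \<omega>) (X k \<omega>))"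
proof (rule M.integrable_const_bound[where B = "2 * D\<^sup>2"])
  show "(\<lambda>\<omega>. \<phi> (x k \<omega>) (X k \<omega>)) \<in> borel_measurable M"
    using measurable_compose[OF measurable_Pair[OF x_measurable X_measurable] \<phi>_measurable, of k k] by simp
qed (use abs_\<phi>_le X_in_space in auto)

text \<open>The descent inequality for one update, solved for the squared gradient. Splitting off
  \<open>\<phi>\<close> isolates the noise; the error \<open>e k\<close> costs at most
  \<open>D * (\<gamma> k * norm (e k))\<close>, and \<open>a k\<close> bounds the quadratic
  term.\<close>

lemma descent_step:
  "\<gamma> k * (norm (G (x k \<omega>)))\<^sup>2
    \<le> f (x k \<omega>) - f (x (Suc k) \<omega>) + \<gamma> k * \<phi> (x k \<omega>) (X k \<omega>) + D * (\<gamma> k * norm (e k)) + L * (a k)\<^sup>2" if \<omega>: "\<omega> \<in> space M"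
proof -
  let ?y = "x k \<omega>" and ?g = "g (x k \<omega>) (X k \<omega>)"
  have "f (x (Suc k) \<omega>) \<le> f ?y + inner (x (Suc k) \<omega> - ?y) (G ?y) + L * (norm (x (Suc k) \<omega> - ?y))\<^sup>2"
    using f G_lipschitz L0 by (intro lipschitz_gradient_descent) (auto simp: G_def)
  also have "inner (x (Suc k) \<omega> - ?y) (G ?y) = - \<gamma> k * inner ?g (G ?y) - \<gamma> k * inner (e k) (G ?y)"
    by (simp add: step[OF \<omega>] inner_add_left algebra_simps)
  also have "inner ?g (G ?y) = (norm (G ?y))\<^sup>2 - \<phi> ?y (X k \<omega>)"
    by (simp add: \<phi>_def inner_diff_right power2_norm_eq_inner inner_commute)
  finally have 1: "\<gamma> k * (norm (G ?y))\<^sup>2 \<le> f ?y - f (x (Suc k) \<omega>) + \<gamma> k * \<phi> ?y (X k \<omega>)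
      - \<gamma> k * inner (e k) (G ?y) + L * (norm (x (Suc k) \<omega> - ?y))\<^sup>2"
    by (simp add: algebra_simps)
  have "- inner (e k) (G ?y) \<le> norm (e k) * norm (G ?y)"
    using Cauchy_Schwarz_ineq2[of "e k" "G ?y"] by linarith
  also have "\<dots> \<le> norm (e k) * D" by (intro mult_left_mono norm_G_le) simp
  finally have 2: "- (\<gamma> k * inner (e k) (G ?y)) \<le> D * (\<gamma> k * norm (e k))"
    using mult_left_mono[of "- inner (e k) (G ?y)" "norm (e k) * D" "\<gamma> k"] \<gamma>(1)[of k]
    by (simp add: mult_ac)
  have 3: "L * (norm (x (Suc k) \<omega> - ?y))\<^sup>2 \<le> L * (a k)\<^sup>2"
    using norm_step_le[OF \<omega>, of k] L0 by (intro mult_left_mono power_mono) auto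
  from 1 2 3 show ?thesis by linarith
qed

text \<open>Summing \<open>descent_step\<close> telescopes \<open>f\<close>, which is bounded below.
  After taking expectations, the noise and the remaining terms are dominated by the summable
  sequence \<open>s\<close>, so the partial sums are bounded.\<close>

lemma summable_expected_gradient: "summable (\<lambda>k. \<gamma> k * (\<integral>\<omega>. (norm (G (x k \<omega>)))\<^sup>2 \<partial>M))"
proof -
  obtain C where C: "C > 0" and mix: "\<And>t z (h :: 's \<Rightarrow> real) B. z \<in> space S \<Longrightarrow> h \<in> borel_measurable S \<Longrightarrow>
      (\<And>s. s \<in> space S \<Longrightarrow> \<bar>h s\<bar> \<le> B) \<Longrightarrow> (\<integral>s. h s \<partial>S) = 0 \<Longrightarrow>
      (\<integral>s. h s \<partial>kernel_power S K t z) \<le> B * (C * r ^ t)"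
    using geometric_mixingE[OF mixing S.prob_space_axioms K_measurable] by metis
  define \<Lambda> where "\<Lambda> = 4 * D * L"
  define B where "B = 2 * D\<^sup>2"
  have \<Lambda>0: "0 \<le> \<Lambda>" using D_nonneg L0 by (simp add: \<Lambda>_def)
  define q where "q k = (\<integral>\<omega>. \<phi> (x k \<omega>) (X k \<omega>) \<partial>M)" for k
  have q: "q k \<le> B * (C * r ^ k) + (\<Sum>j<k. \<Lambda> * a j * (C * r ^ (k - j)))" for k
    unfolding q_def
  proof (rule markov_noise_bound[where H = H and ?x0.0 = x0, OF mc mix H_measurable])
    show "(\<lambda>(y, s). \<phi> y s) \<in> borel_measurable (borel \<Otimes>\<^sub>M S)" by (rule \<phi>_measurable)
  qed (use x0 step norm_step_le \<phi>_integrable \<phi>_mean_zero abs_\<phi>_le \<phi>_lipschitz \<Lambda>0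
      in \<open>auto simp: H_def dist_norm B_def \<Lambda>_def\<close>)
  \<comment> \<open>The stepsizes tend to 0 because their squares are summable; hence they are
    bounded.\<close>
  obtain \<Gamma> where \<Gamma>: "\<And>k. \<gamma> k \<le> \<Gamma>"
  proof -
    have "(\<lambda>k. sqrt ((\<gamma> k)\<^sup>2)) \<longlonglongrightarrow> sqrt 0"
      using summable_LIMSEQ_zero[OF \<gamma>(2)] by (rule tendsto_real_sqrt)
    then have "Bseq \<gamma>" using \<gamma>(1) by (simp add: less_imp_le convergent_imp_Bseq convergentI)
    then obtain b where "\<And>n. norm (\<gamma> n) \<le> b" unfolding Bseq_def by blast
    then show thesis by (intro that[of b]) (auto intro: abs_le_D1)
  qed
  have \<Gamma>0: "0 \<le> \<Gamma>" using \<Gamma>[of 0] \<gamma>(1)[of 0] by linarith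
  \<comment> \<open>\<open>c\<close> decouples the indices in \<open>\<gamma> k * a j\<close>: AM-GM
    splits \<open>\<gamma> k * \<gamma> j\<close>, and \<open>\<Gamma>\<close> replaces
    \<open>\<gamma> k\<close> in the error part. Of the bound
    \<open>D * (\<gamma> k)^2 + c j\<close>, the first part will meet a geometric sum over
    \<open>j\<close>, the second a geometric convolution.\<close>
  define c where "c j = D * (\<gamma> j)\<^sup>2 + \<Gamma> * (\<gamma> j * norm (e j))" for j
  have sc: "summable c" unfolding c_def by (intro summable_add summable_mult \<gamma>(2) e)
  have c0: "0 \<le> c j" for j using D_nonneg \<Gamma>0 \<gamma>(1)[of j] by (simp add: c_def)
  have \<gamma>a: "\<gamma> k * a j \<le> D * (\<gamma> k)\<^sup>2 + c j" for k j
  proof -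
    have "\<gamma> k * \<gamma> j \<le> (\<gamma> k)\<^sup>2 + (\<gamma> j)\<^sup>2"
      using sum_squares_bound[of "\<gamma> k" "\<gamma> j"] mult_pos_pos[OF \<gamma>(1)[of k] \<gamma>(1)[of j]]
      by linarith
    from mult_left_mono[OF this D_nonneg] have "D * (\<gamma> k * \<gamma> j) \<le> D * (\<gamma> k)\<^sup>2 + D * (\<gamma> j)\<^sup>2"
      by (simp add: distrib_left)
    moreover have "\<gamma> k * (\<gamma> j * norm (e j)) \<le> \<Gamma> * (\<gamma> j * norm (e j))"
      using \<Gamma>[of k] \<gamma>(1)[of j] by (intro mult_right_mono) auto
    ultimately show ?thesis by (simp add: a_def c_def algebra_simps)
  qed
  \<comment> \<open>Adding the term \<open>j = k\<close> turns the sum into an initial segment of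
    the geometric series after reversal.\<close>
  have geo: "(\<Sum>j<k. r ^ (k - j)) \<le> 1 / (1 - r)" for k
  proof -
    have "(\<Sum>j<k. r ^ (k - j)) \<le> (\<Sum>j<Suc k. r ^ (k - j))"
      using r by (intro sum_mono2) auto
    also have "\<dots> = (\<Sum>j<Suc k. r ^ j)"
      using sum.nat_diff_reindex[of "\<lambda>j. r ^ j" "Suc k"] by simp
    also have "\<dots> \<le> (\<Sum>j. r ^ j)"
      using r by (intro sum_le_suminf) auto
    finally show ?thesis using r by (simp add: suminf_geometric)
  qed
  define d where "d k = D * (\<gamma> k * norm (e k)) + L * (a k)\<^sup>2" for k
  define s where "s k = B * C * \<Gamma> * r ^ k
      + \<Lambda> * C * (D / (1 - r) * (\<gamma> k)\<^sup>2 + (\<Sum>j<k. r ^ (k - j) * c j)) + d k" for k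
  have "summable (\<lambda>k. (a k)\<^sup>2)"
  proof (rule summable_comparison_test')
    have "summable (\<lambda>k. (D * \<gamma> k)\<^sup>2)"
      using summable_mult[OF \<gamma>(2), of "D\<^sup>2"] by (simp add: power_mult_distrib)
    moreover have "summable (\<lambda>k. (\<gamma> k * norm (e k))\<^sup>2)"
      using \<gamma>(1) by (intro summable_power2_of_summable[OF e]) (simp add: less_imp_le)
    ultimately show "summable (\<lambda>k. 2 * (D * \<gamma> k)\<^sup>2 + 2 * (\<gamma> k * norm (e k))\<^sup>2)"
      by (intro summable_add summable_mult)
    fix k
    have "(a k)\<^sup>2 \<le> 2 * (D * \<gamma> k)\<^sup>2 + 2 * (\<gamma> k * norm (e k))\<^sup>2"
      using sum_squares_bound[of "D * \<gamma> k" "\<gamma> k * norm (e k)"]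
      unfolding a_def power2_sum by linarith
    then show "norm ((a k)\<^sup>2) \<le> 2 * (D * \<gamma> k)\<^sup>2 + 2 * (\<gamma> k * norm (e k))\<^sup>2" by simp
  qed
  then have sd: "summable d"
    unfolding d_def by (intro summable_add summable_mult e)
  have "summable (\<lambda>k. r ^ k)" using r by (intro summable_geometric) simp
  then have ss: "summable s"
    unfolding s_def
    by (intro summable_add summable_mult sd \<gamma>(2) summable_geometric_convolution[OF sc c0 r])
  have d0: "0 \<le> d k" for k using D_nonneg L0 \<gamma>(1)[of k] by (simp add: d_def)
  have s0: "0 \<le> s k" for k
    unfolding s_def B_def using C \<Gamma>0 r \<Lambda>0 D_nonneg c0 d0
    by (intro add_nonneg_nonneg mult_nonneg_nonneg sum_nonneg) auto
  have \<gamma>q: "\<gamma> k * q k + d k \<le> s k" for k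
  proof -
    have "(\<Sum>j<k. r ^ (k - j) * (\<gamma> k * a j)) \<le> (\<Sum>j<k. r ^ (k - j) * (D * (\<gamma> k)\<^sup>2 + c j))"
      using r \<gamma>a by (intro sum_mono mult_left_mono) auto
    also have "\<dots> = D * (\<gamma> k)\<^sup>2 * (\<Sum>j<k. r ^ (k - j)) + (\<Sum>j<k. r ^ (k - j) * c j)"
      by (simp add: distrib_left sum.distrib sum_distrib_left mult_ac)
    also have "\<dots> \<le> D * (\<gamma> k)\<^sup>2 * (1 / (1 - r)) + (\<Sum>j<k. r ^ (k - j) * c j)"
      using D_nonneg by (intro add_right_mono mult_left_mono geo) auto
    finally have conv: "(\<Sum>j<k. r ^ (k - j) * (\<gamma> k * a j))
        \<le> D / (1 - r) * (\<gamma> k)\<^sup>2 + (\<Sum>j<k. r ^ (k - j) * c j)" by simp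
    have "\<gamma> k * q k \<le> \<gamma> k * (B * (C * r ^ k) + (\<Sum>j<k. \<Lambda> * a j * (C * r ^ (k - j))))"
      using q \<gamma>(1)[of k] by (intro mult_left_mono) auto
    also have "\<dots> = B * C * \<gamma> k * r ^ k + \<Lambda> * C * (\<Sum>j<k. r ^ (k - j) * (\<gamma> k * a j))"
      by (simp add: distrib_left sum_distrib_left mult_ac)
    also have "\<dots> \<le> B * C * \<Gamma> * r ^ k
        + \<Lambda> * C * (D / (1 - r) * (\<gamma> k)\<^sup>2 + (\<Sum>j<k. r ^ (k - j) * c j))"
      using C r \<Lambda>0 \<Gamma>
      by (intro add_mono mult_left_mono mult_right_mono conv) (auto simp: B_def)
    finally show ?thesis by (simp add: s_def)
  qed
  let ?P = "\<lambda>k. \<integral>\<omega>. (norm (G (x k \<omega>)))\<^sup>2 \<partial>M"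
  show "summable (\<lambda>k. \<gamma> k * ?P k)"
  proof (rule summableI_nonneg_bounded)
    fix N
    have "(\<Sum>k<N. \<gamma> k * ?P k) = (\<integral>\<omega>. (\<Sum>k<N. \<gamma> k * (norm (G (x k \<omega>)))\<^sup>2) \<partial>M)"
      using G_square_integrable by (subst Bochner_Integration.integral_sum) auto
    also have "\<dots> \<le> (\<integral>\<omega>. f x0 - fmin + (\<Sum>k<N. \<gamma> k * \<phi> (x k \<omega>) (X k \<omega>) + d k) \<partial>M)"
    proof (rule integral_mono)
      fix \<omega> assume \<omega>: "\<omega> \<in> space M"
      have "(\<Sum>k<N. \<gamma> k * (norm (G (x k \<omega>)))\<^sup>2)
          \<le> (\<Sum>k<N. (f (x k \<omega>) - f (x (Suc k) \<omega>)) + (\<gamma> k * \<phi> (x k \<omega>) (X k \<omega>) + d k))"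
        using descent_step[OF \<omega>] by (intro sum_mono) (simp add: d_def add.assoc)
      also have "\<dots> = f (x 0 \<omega>) - f (x N \<omega>) + (\<Sum>k<N. \<gamma> k * \<phi> (x k \<omega>) (X k \<omega>) + d k)"
        using sum_lessThan_telescope'[of "\<lambda>k. f (x k \<omega>)" N] by (simp add: sum.distrib)
      finally show "(\<Sum>k<N. \<gamma> k * (norm (G (x k \<omega>)))\<^sup>2)
          \<le> f x0 - fmin + (\<Sum>k<N. \<gamma> k * \<phi> (x k \<omega>) (X k \<omega>) + d k)"
        using fmin[of "x N \<omega>"] x0[OF \<omega>] by simp
    qed (use G_square_integrable \<phi>_integrable_trajectory in auto)
    also have "\<dots> = f x0 - fmin + (\<Sum>k<N. \<gamma> k * q k + d k)"
      using \<phi>_integrable_trajectory by (simp add: q_def M.prob_space)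
    also have "\<dots> \<le> f x0 - fmin + (\<Sum>k<N. s k)"
      by (intro add_left_mono sum_mono \<gamma>q)
    also have "\<dots> \<le> f x0 - fmin + suminf s"
      using ss s0 by (intro add_left_mono sum_le_suminf) auto
    finally show "(\<Sum>k<N. \<gamma> k * ?P k) \<le> f x0 - fmin + suminf s" .
  qed (use \<gamma>(1) in \<open>simp add: less_imp_le\<close>)
qed

end

section \<open>Convergence of the mean gradient norm and the rate\<close>

theorem corollary2:
  fixes F :: "real ^ 'n \<Rightarrow> 's \<Rightarrow> real"
    and \<pi> :: "'s measure"
    and K :: "'s \<Rightarrow> 's measure"
    and M :: "'w measure"
    and \<xi> :: "nat \<Rightarrow> 'w \<Rightarrow> 's"
    and x :: "nat \<Rightarrow> 'w \<Rightarrow> real ^ 'n"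
    and x0 :: "real ^ 'n"
    and e :: "nat \<Rightarrow> real ^ 'n"
    and \<gamma> :: "nat \<Rightarrow> real"
    and L r :: real
  assumes "prob_space \<pi>"
    and "\<And>y. integrable \<pi> (F y)"
    and "\<And>y s. s \<in> space \<pi> \<Longrightarrow> (\<lambda>z. F z s) differentiable (at y)"
    and "\<And>y z s. s \<in> space \<pi> \<Longrightarrow>
           norm (grad (\<lambda>u. F u s) y - grad (\<lambda>u. F u s) z) \<le> L * norm (y - z)"
    and "bdd_above {norm (grad (\<lambda>u. F u s) y) | y s. s \<in> space \<pi>}"
    and "\<And>y. GDERIV (\<lambda>u. \<integral>s. F u s \<partial>\<pi>) y :> (\<integral>s. grad (\<lambda>u. F u s) y \<partial>\<pi>)"
    and "\<exists>y. \<forall>z. (\<integral>s. F y s \<partial>\<pi>) \<le> (\<integral>s. F z s \<partial>\<pi>)"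
    and "markov_chain M \<pi> K \<xi>"
    and "irreducible_kernel \<pi> K"
    and "aperiodic_kernel K \<pi>"
    and "stationary K \<pi>"
    and "reversible K \<pi>"
    and "0 < r" and "r < 1" and "geometric_mixing K \<pi> r"
    and "\<And>k. \<gamma> k > 0"
    and "filterlim (\<lambda>n. \<Sum>k<n. \<gamma> k) at_top sequentially"
    and "summable (\<lambda>k. (ln (real (Suc k)))\<^sup>2 * (\<gamma> (Suc k))\<^sup>2)"
    and "summable (\<lambda>k. \<gamma> (Suc k) * norm (e (Suc k)))"
    and "\<And>\<omega>. \<omega> \<in> space M \<Longrightarrow> x 0 \<omega> = x0"
    and "\<And>k \<omega>. \<omega> \<in> space M \<Longrightarrow>
           x (Suc k) \<omega> = x k \<omega> - \<gamma> k *\<^sub>R (grad (\<lambda>u. F u (\<xi> k \<omega>)) (x k \<omega>) + e k)"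
  shows "(\<lambda>k. \<integral>\<omega>. norm (grad (\<lambda>u. \<integral>s. F u s \<partial>\<pi>) (x k \<omega>)) \<partial>M) \<longlonglongrightarrow> 0
    \<and> (\<lambda>k. \<integral>\<omega>. (MIN i\<in>{1..k}. (norm (grad (\<lambda>u. \<integral>s. F u s \<partial>\<pi>) (x i \<omega>)))\<^sup>2) \<partial>M)
        \<in> O(\<lambda>k. max 1 (1 / ln (1 / r)) / (\<Sum>i=1..k. \<gamma> i))"
proof -
  interpret \<pi>: prob_space \<pi> by (rule assms(1))
  define g where "g y s = grad (\<lambda>u. F u s) y" for y s
  let ?f = "\<lambda>u. \<integral>s. F u s \<partial>\<pi>"
  have gm: "g y \<in> borel_measurable \<pi>" for y
    unfolding g_def using assms(2,3) by (intro borel_measurable_grad) auto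
  obtain D where gb: "\<And>y s. s \<in> space \<pi> \<Longrightarrow> norm (g y s) \<le> D"
    using assms(5) unfolding bdd_above_def g_def by blast
  \<comment> \<open>The locale takes a nonnegative Lipschitz constant, while the sign of
    \<open>L\<close> is not prescribed; hence the absolute value.\<close>
  have gl: "norm (g y s - g z s) \<le> \<bar>L\<bar> * norm (y - z)" if "s \<in> space \<pi>" for y z s
    using assms(4)[OF that, of y z] mult_right_mono[OF abs_ge_self[of L], of "norm (y - z)"]
    by (simp add: g_def)
  have fG: "GDERIV ?f y :> (\<integral>s. g y s \<partial>\<pi>)" for y
    using assms(6) by (simp add: g_def)
  obtain ym where ym: "\<And>z. ?f ym \<le> ?f z" using assms(7) by blast
  have s2: "summable (\<lambda>k. (\<gamma> k)\<^sup>2)" using assms(18) by (rule summable_of_log_weighted) simp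
  have se: "summable (\<lambda>k. \<gamma> k * norm (e k))"
    using assms(19) by (subst (asm) summable_Suc_iff)
  have st: "x (Suc k) \<omega> = x k \<omega> - \<gamma> k *\<^sub>R (g (x k \<omega>) (\<xi> k \<omega>) + e k)" if "\<omega> \<in> space M" for k \<omega>
    using assms(21)[OF that] by (simp add: g_def)
  interpret sgd: markov_sgd \<pi> M K \<xi> r D "\<bar>L\<bar>" "?f ym" ?f g \<gamma> e x x0
    by unfold_locales (use assms(8,13,14,15,16,20) gm gb gl fG ym s2 se st in auto)
  have gradf: "grad ?f y = sgd.G y" for y
    unfolding sgd.G_def by (rule grad_eqI[OF fG])
  note [measurable] = sgd.x_measurable sgd.G_measurable
  define P where "P k = (\<integral>\<omega>. (norm (sgd.G (x k \<omega>)))\<^sup>2 \<partial>M)" for k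
  define b where "b k = (\<integral>\<omega>. norm (sgd.G (x k \<omega>)) \<partial>M)" for k
  have b0: "0 \<le> b k" for k unfolding b_def by simp
  have P0: "0 \<le> P k" for k unfolding P_def by simp
  have sP: "summable (\<lambda>k. \<gamma> k * P k)" unfolding P_def by (rule sgd.summable_expected_gradient)
  \<comment> \<open>The increments of \<open>b\<close> are controlled because \<open>sgd.G\<close>
    is Lipschitz and step lengths are at most \<open>sgd.a k\<close>. This gives
    \<open>c = \<bar>L\<bar> * D\<close>, with the error part of the step as
    \<open>\<epsilon>\<close>.\<close>
  have "b \<longlonglongrightarrow> 0"
  proof (rule tendsto_zero_of_weighted_square_summable)
    show "b k \<le> D" for k
      unfolding b_def using sgd.G_integrable sgd.norm_G_le by (intro sgd.M.integral_le_const) auto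
    show "\<bar>b (Suc k) - b k\<bar> \<le> \<bar>L\<bar> * D * \<gamma> k + \<bar>L\<bar> * (\<gamma> k * norm (e k))" for k
    proof -
      have "\<bar>b (Suc k) - b k\<bar> = \<bar>\<integral>\<omega>. norm (sgd.G (x (Suc k) \<omega>)) - norm (sgd.G (x k \<omega>)) \<partial>M\<bar>"
        unfolding b_def using sgd.G_integrable by simp
      also have "\<dots> \<le> (\<integral>\<omega>. \<bar>norm (sgd.G (x (Suc k) \<omega>)) - norm (sgd.G (x k \<omega>))\<bar> \<partial>M)"
        by (rule integral_abs_bound)
      also have "\<dots> \<le> \<bar>L\<bar> * (D * \<gamma> k + \<gamma> k * norm (e k))"
      proof (rule sgd.M.integral_le_const)
        have "\<bar>norm (sgd.G (x (Suc k) \<omega>)) - norm (sgd.G (x k \<omega>))\<bar> \<le> \<bar>L\<bar> * (D * \<gamma> k + \<gamma> k * norm (e k))"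
          if "\<omega> \<in> space M" for \<omega>
          using norm_triangle_ineq3 sgd.G_lipschitz
            mult_left_mono[OF sgd.norm_step_le[OF that, unfolded sgd.a_def] abs_ge_zero]
          by (rule order_trans[OF order_trans])
        then show "AE \<omega> in M. \<bar>norm (sgd.G (x (Suc k) \<omega>)) - norm (sgd.G (x k \<omega>))\<bar>
            \<le> \<bar>L\<bar> * (D * \<gamma> k + \<gamma> k * norm (e k))" by auto
      qed (use sgd.G_integrable in auto)
      finally show ?thesis by (simp add: algebra_simps)
    qed
    show "summable (\<lambda>k. \<gamma> k * (b k)\<^sup>2)"
    proof (rule summable_comparison_test'[OF sP])
      fix k
      \<comment> \<open>Nonnegative variance gives \<open>(b k)^2 \<le> P k\<close>, which transfers
        summability from second moments to \<open>b\<close>.\<close>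
      have "0 \<le> (\<integral>\<omega>. (norm (sgd.G (x k \<omega>)) - b k)\<^sup>2 \<partial>M)" by simp
      also have "\<dots> = P k - (b k)\<^sup>2"
        using sgd.M.variance_eq[OF sgd.G_integrable sgd.G_square_integrable, of k] by (simp add: P_def b_def)
      finally have "(b k)\<^sup>2 \<le> P k" by simp
      then have "\<gamma> k * (b k)\<^sup>2 \<le> \<gamma> k * P k"
        using assms(16)[of k] by (intro mult_left_mono) auto
      then show "norm (\<gamma> k * (b k)\<^sup>2) \<le> \<gamma> k * P k"
        using assms(16)[of k] by simp
    qed
    show "\<not> summable \<gamma>"
    proof
      assume "summable \<gamma>"
      then have "(\<lambda>n. \<Sum>k<n. \<gamma> k) \<longlonglongrightarrow> suminf \<gamma>" by (rule summable_LIMSEQ)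
      with assms(17) show False
        using not_tendsto_and_filterlim_at_infinity[OF sequentially_bot]
          filterlim_at_top_imp_at_infinity by blast
    qed
  qed (use b0 sgd.D_nonneg assms(16) s2 se in \<open>auto intro!: mult_nonneg_nonneg summable_mult simp: less_imp_le\<close>)
  moreover have "(\<lambda>k. \<integral>\<omega>. (MIN i\<in>{1..k}. (norm (sgd.G (x i \<omega>)))\<^sup>2) \<partial>M)
      \<in> O(\<lambda>k. max 1 (1 / ln (1 / r)) / (\<Sum>i=1..k. \<gamma> i))"
  \<comment> \<open>The constant is the full sum from index 0. The estimate starts at
    \<open>k = 1\<close>, where the minimum first ranges over a nonempty set and the sum of
    stepsizes is positive.\<close>
  proof (rule bigoI[where c = "\<Sum>k. \<gamma> k * P k"], rule eventually_sequentiallyI[of 1])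
    fix k :: nat assume k: "1 \<le> k"
    let ?m = "\<lambda>\<omega>. MIN i\<in>{1..k}. (norm (sgd.G (x i \<omega>)))\<^sup>2"
    let ?T = "\<Sum>i=1..k. \<gamma> i"
    have T: "0 < ?T" using k assms(16) by (intro sum_pos) auto
    have ne: "finite {1..k}" "{1..k} \<noteq> {}" using k by auto
    have m0: "0 \<le> ?m \<omega>" for \<omega> using ne by (subst Min_ge_iff) auto
    have ml: "?m \<omega> \<le> (norm (sgd.G (x i \<omega>)))\<^sup>2" if "i \<in> {1..k}" for i \<omega>
      using that by (intro Min_le) auto
    have [measurable]: "?m \<in> borel_measurable M"
      using ne by (intro borel_measurable_Min) auto
    have Im: "integrable M ?m"
      by (rule Bochner_Integration.integrable_bound[OF sgd.G_square_integrable[of 1]])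
        (use m0 ml[of 1] k in \<open>auto simp: abs_of_nonneg\<close>)
    \<comment> \<open>The minimum lies below each squared norm, hence its mean below each
      \<open>P i\<close>; weighting by \<open>\<gamma> i\<close> and summing brings in the
      convergent series.\<close>
    have "?T * (\<integral>\<omega>. ?m \<omega> \<partial>M) = (\<Sum>i=1..k. \<gamma> i * (\<integral>\<omega>. ?m \<omega> \<partial>M))"
      by (rule sum_distrib_right)
    also have "\<dots> \<le> (\<Sum>i=1..k. \<gamma> i * P i)"
      unfolding P_def using assms(16) Im sgd.G_square_integrable ml
      by (intro sum_mono mult_left_mono integral_mono) (auto simp: less_imp_le)
    also have "\<dots> \<le> (\<Sum>k. \<gamma> k * P k)"
      using sP P0 assms(16) by (intro sum_le_suminf) (auto simp: less_imp_le)
    finally have "(\<integral>\<omega>. ?m \<omega> \<partial>M) \<le> (\<Sum>k. \<gamma> k * P k) * (1 / ?T)"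
      using T by (simp add: field_simps)
    also have "\<dots> \<le> (\<Sum>k. \<gamma> k * P k) * (max 1 (1 / ln (1 / r)) / ?T)"
      using T sP P0 assms(16)
      by (intro mult_left_mono divide_right_mono suminf_nonneg) (auto simp: less_imp_le)
    finally show "norm (\<integral>\<omega>. ?m \<omega> \<partial>M) \<le> (\<Sum>k. \<gamma> k * P k) * norm (max 1 (1 / ln (1 / r)) / ?T)"
      using T m0 by (simp add: abs_of_nonneg)
  qed
  ultimately show ?thesis unfolding gradf b_def by simp
qed

end
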